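(* Let $n\ge 2$ and let $K\subset\mathbb{R}^n$ be a bounded measurable set which is not contained in any $1$-dimensional linear subspace. Then $$V(K)\,V(K^{\diamond})\le\omega_n^2.$$ If in addition $K$ is a star body, equality holds if and only if $K$ is an origin-symmetric ellipsoid when $n=2$, and is an origin-symmetric Euclidean ball when $n\ge3$.
   Context: $V$ denotes volume (Lebesgue measure) in $\mathbb{R}^n$, $\omega_n=\pi^{n/2}/\Gamma(1+n/2)$ is the volume of the Euclidean unit ball. For $x,y\in\mathbb{R}^n$ let $[x,y]=\sqrt{|x|^2|y|^2-(x\cdot y)^2}$. The sine polar body of a set $K\subset\mathbb{R}^n$ is $K^{\diamond}=\{x\in\mathbb{R}^n: [x,y]\le 1 \text{ for all } y\in K\}$. A star body is a set of the form $\{ru: u\in S^{n-1}, 0\le r\le\rho(u)\}$ with $\rho:S^{n-1}\to(0,\infty)$ continuous. *)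

theory Defs
  imports "HOL-Analysis.Analysis"
begin

definition sine_bracket :: "'a::euclidean_space \<Rightarrow> 'a \<Rightarrow> real" where
  "sine_bracket x y = sqrt ((norm x)\<^sup>2 * (norm y)\<^sup>2 - (x \<bullet> y)\<^sup>2)"

definition sine_polar :: "'a::euclidean_space set \<Rightarrow> 'a set" where
  "sine_polar K = {x. \<forall>y\<in>K. sine_bracket x y \<le> 1}"

text \<open>Volume of the Euclidean unit ball in R^n: pi^(n/2) / Gamma(1 + n/2).\<close>
definition omega :: "nat \<Rightarrow> real" where
  "omega n = pi powr (real n / 2) / Gamma (1 + real n / 2)"

definition star_body :: "'a::euclidean_space set \<Rightarrow> bool" where
  "star_body K \<longleftrightarrow> (\<exists>\<rho>::'a \<Rightarrow> real. continuous_on (sphere 0 1) \<rho> \<and> (\<forall>u\<in>sphere 0 1. \<rho> u > 0) \<and>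
      K = {r *\<^sub>R u | r u. u \<in> sphere 0 1 \<and> 0 \<le> r \<and> r \<le> \<rho> u})"

definition origin_ellipsoid :: "'a::euclidean_space set \<Rightarrow> bool" where
  "origin_ellipsoid E \<longleftrightarrow> (\<exists>f::'a \<Rightarrow> 'a. linear f \<and> inj f \<and> E = f ` cball 0 1)"

definition origin_ball :: "'a::euclidean_space set \<Rightarrow> bool" where
  "origin_ball B \<longleftrightarrow> (\<exists>r>0. B = cball 0 r)"

end

theory Submission
  imports Defs "HOL-Complex_Analysis.Great_Picard"
begin

text \<open>For \<open>x, y\<close> orthogonal to a unit vector \<open>u\<close> one has
  \<open>[x + t u, y + s u]\<^sup>2 = [x, y]\<^sup>2 + |t y - s x|\<^sup>2\<close>, which is jointly convex and even in \<open>(t, s)\<close>.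
  Hence Steiner symmetrisation of \<open>K\<close> and of its sine polar \<open>L\<close> \<^emph>\<open>in the same direction\<close> preserves the
  constraint \<open>[x, y] \<le> 1\<close> on \<open>L \<times> K\<close>, without decreasing volumes. By compactness a maximising pair exists
  among all pairs lying between two balls, and for a maximiser the symmetrals are again mutually
  polar. So for every maximal chord \<open>[p, z]\<close> of \<open>K\<close> in direction \<open>u\<close> there are points \<open>a, b\<close> of \<open>L\<close>, on a
  line in direction \<open>u\<close>, with \<open>[a, p] = [b, z] = 1\<close> and with proportional midpoints.

  If \<open>n \<ge> 3\<close> and \<open>p\<close> is a point of the boundary of \<open>K\<close> nearest to \<open>q \<noteq> 0\<close>, then the normal at \<open>p\<close> is unique, and
  the chords through \<open>p\<close> contradict this unless \<open>p\<close> and \<open>q\<close> are collinear; letting \<open>q\<close> tend to \<open>0\<close> shows that \<open>K\<close> is a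
  ball. If \<open>n = 2\<close>, the contact points of the chords through a point nearest to \<open>0\<close> determine a supporting line at
  every boundary point; this is a differential equation for the boundary whose solutions are ellipses.
  The inequality follows by evaluating the maximisers, and conversely equality makes \<open>K\<close> maximal.\<close>

section \<open>The bracket and sine polars\<close>

lemma sine_bracket_commute: "sine_bracket x y = sine_bracket y x"
  by (simp add: sine_bracket_def inner_commute mult.commute)

lemma sine_bracket_square:
  "(sine_bracket x y)\<^sup>2 = (norm x)\<^sup>2 * (norm y)\<^sup>2 - (x \<bullet> y)\<^sup>2"
proof -
  have "(x \<bullet> y)\<^sup>2 \<le> (norm x)\<^sup>2 * (norm y)\<^sup>2"
    using Cauchy_Schwarz_ineq[of x y] by (simp add: power2_norm_eq_inner)
  then show ?thesis
    by (simp add: sine_bracket_def)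
qed

text \<open>This is \<open>norm x\<close> times the component of \<open>y\<close> orthogonal to
  \<open>x\<close>. Writing the bracket as the norm of a vector that is linear in \<open>y\<close>
  makes \<open>sine_bracket x\<close> a seminorm.\<close>

definition wedge_vec :: "'a::euclidean_space \<Rightarrow> 'a \<Rightarrow> 'a" where
  "wedge_vec x y = norm x *\<^sub>R y - ((x \<bullet> y) / norm x) *\<^sub>R x"

lemma linear_wedge_vec: "linear (wedge_vec x)"
  by (auto simp: wedge_vec_def linear_iff inner_add_right algebra_simps add_divide_distrib)

lemma inner_wedge_vec:
  "wedge_vec x y \<bullet> wedge_vec x z = (norm x)\<^sup>2 * (y \<bullet> z) - (x \<bullet> y) * (x \<bullet> z)"
proof (cases "x = 0")
  case False
  then have "x \<bullet> x = norm x * norm x" "norm x \<noteq> 0"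
    by (auto simp: power2_norm_eq_inner[symmetric] power2_eq_square)
  then show ?thesis
    by (simp add: wedge_vec_def inner_diff_left inner_diff_right inner_commute field_simps power2_eq_square)
qed (simp add: wedge_vec_def)

lemma sine_bracket_wedge_vec: "sine_bracket x y = norm (wedge_vec x y)"
  by (simp add: sine_bracket_def norm_eq_sqrt_inner inner_wedge_vec power2_norm_eq_inner power2_eq_square)

lemma sine_bracket_nonneg [simp]: "0 \<le> sine_bracket x y"
  by (simp add: sine_bracket_wedge_vec)

lemma sine_bracket_zero [simp]: "sine_bracket x 0 = 0" "sine_bracket 0 x = 0"
  by (simp_all add: sine_bracket_def)

lemma sine_bracket_self [simp]: "sine_bracket x x = 0"
  by (simp add: sine_bracket_def flip: power2_norm_eq_inner)

lemma sine_bracket_minus [simp]: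
  "sine_bracket x (- y) = sine_bracket x y" "sine_bracket (- x) y = sine_bracket x y"
  by (simp_all add: sine_bracket_def)

lemma sine_bracket_scaleR [simp]:
  "sine_bracket x (c *\<^sub>R y) = \<bar>c\<bar> * sine_bracket x y"
  "sine_bracket (c *\<^sub>R x) y = \<bar>c\<bar> * sine_bracket x y"
proof -
  show *: "sine_bracket x (c *\<^sub>R y) = \<bar>c\<bar> * sine_bracket x y" for x y :: 'a
    by (simp add: sine_bracket_wedge_vec linear_cmul[OF linear_wedge_vec])
  show "sine_bracket (c *\<^sub>R x) y = \<bar>c\<bar> * sine_bracket x y"
    by (metis * sine_bracket_commute)
qed

lemma sine_bracket_triangle: "sine_bracket x (y + z) \<le> sine_bracket x y + sine_bracket x z"
  by (simp add: sine_bracket_wedge_vec linear_add[OF linear_wedge_vec] norm_triangle_ineq)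

lemma sine_bracket_le: "sine_bracket x y \<le> norm x * norm y"
  by (rule power2_le_imp_le) (auto simp: sine_bracket_square power_mult_distrib)

lemma sine_bracket_orthogonal: "x \<bullet> y = 0 \<Longrightarrow> sine_bracket x y = norm x * norm y"
  by (simp add: sine_bracket_def real_sqrt_mult)

lemma sine_bracket_eq_0D:
  assumes "sine_bracket x y = 0" "x \<noteq> 0"
  shows "y = ((x \<bullet> y) / (norm x)\<^sup>2) *\<^sub>R x"
proof -
  have "norm x *\<^sub>R y = ((x \<bullet> y) / norm x) *\<^sub>R x"
    using assms(1) by (simp add: sine_bracket_wedge_vec wedge_vec_def)
  then have "(1 / norm x) *\<^sub>R (norm x *\<^sub>R y) = (1 / norm x) *\<^sub>R ((x \<bullet> y) / norm x) *\<^sub>R x"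
    by simp
  then show ?thesis
    using assms(2) by (simp add: power2_eq_square)
qed

lemma continuous_on_sine_bracket [continuous_intros]:
  assumes "continuous_on S f" "continuous_on S g"
  shows "continuous_on S (\<lambda>x. sine_bracket (f x) (g x))"
  unfolding sine_bracket_def by (intro continuous_intros assms)

text \<open>The exterior product of the two vectors is that of \<open>x\<close> and \<open>y\<close>
  plus that of \<open>u\<close> and \<open>t *\<^sub>R y - s *\<^sub>R x\<close>; the two parts are
  orthogonal because \<open>u\<close> is orthogonal to \<open>x\<close> and
  \<open>y\<close>.\<close>

lemma sine_bracket_split_square:
  assumes "norm u = 1" "x \<bullet> u = 0" "y \<bullet> u = 0"
  shows "(sine_bracket (x + t *\<^sub>R u) (y + s *\<^sub>R u))\<^sup>2
    = (sine_bracket x y)\<^sup>2 + (norm (t *\<^sub>R y - s *\<^sub>R x))\<^sup>2"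
proof -
  have "u \<bullet> u = 1" "u \<bullet> x = 0" "u \<bullet> y = 0"
    using assms by (auto simp: power2_norm_eq_inner[symmetric] inner_commute)
  then show ?thesis
    using assms
    by (simp add: sine_bracket_square power2_norm_eq_inner inner_add_left inner_add_right
        inner_diff_left inner_diff_right inner_commute)
      (simp add: algebra_simps power2_eq_square)
qed

section \<open>Duality, convexity and size of sine polars\<close>

lemma in_sine_polar_iff: "x \<in> sine_polar K \<longleftrightarrow> (\<forall>y\<in>K. sine_bracket x y \<le> 1)"
  by (simp add: sine_polar_def)

lemma sine_polar_antimono: "K \<subseteq> L \<Longrightarrow> sine_polar L \<subseteq> sine_polar K"
  by (fastforce simp: in_sine_polar_iff)

lemma subset_sine_polar_iff:
  "L \<subseteq> sine_polar K \<longleftrightarrow> (\<forall>x\<in>K. \<forall>y\<in>L. sine_bracket x y \<le> 1)"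
  by (metis in_sine_polar_iff sine_bracket_commute subset_iff)

lemma subset_sine_polar_swap: "L \<subseteq> sine_polar K \<longleftrightarrow> K \<subseteq> sine_polar L"
  by (metis subset_sine_polar_iff sine_bracket_commute)

lemma subset_sine_polar_sine_polar: "K \<subseteq> sine_polar (sine_polar K)"
  using subset_sine_polar_swap by blast

lemma sine_polar_triple: "sine_polar (sine_polar (sine_polar K)) = sine_polar K"
  by (simp add: subset_antisym sine_polar_antimono subset_sine_polar_sine_polar)

lemma minus_mem_sine_polar: "x \<in> sine_polar K \<Longrightarrow> - x \<in> sine_polar K"
  by (simp add: in_sine_polar_iff)

lemma sine_polar_eq_INT: "sine_polar K = (\<Inter>y\<in>K. {x. sine_bracket y x \<le> 1})"
  by (auto simp: in_sine_polar_iff sine_bracket_commute)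

lemma convex_sine_polar: "convex (sine_polar K)"
proof -
  have "convex {x. sine_bracket y x \<le> 1}" for y :: 'a
  proof -
    have "{x. sine_bracket y x \<le> 1} = wedge_vec y -` cball 0 1"
      by (auto simp: sine_bracket_wedge_vec)
    then show ?thesis
      using convex_linear_vimage[OF linear_wedge_vec convex_cball, of y 0 1] by simp
  qed
  then show ?thesis
    unfolding sine_polar_eq_INT by (intro convex_INT) auto
qed

lemma closed_sine_polar: "closed (sine_polar K)"
  unfolding sine_polar_eq_INT
  by (intro closed_INT ballI closed_Collect_le continuous_intros)

lemma exists_orthogonal_unit:
  fixes x :: "'a::euclidean_space"
  assumes "DIM('a) \<ge> 2"
  obtains v where "x \<bullet> v = 0" "norm v = 1"
proof -
  obtain w where "w \<noteq> 0" "orthogonal x w"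
    using orthogonal_to_vector_exists[OF assms] by metis
  then show ?thesis
    by (intro that[of "(1 / norm w) *\<^sub>R w"]) (auto simp: orthogonal_def)
qed

text \<open>A unit vector \<open>v\<close> orthogonal to \<open>x\<close>, available from dimension
  two on, satisfies \<open>sine_bracket x (r *\<^sub>R v) = r * norm x\<close>, and
  \<open>r *\<^sub>R v\<close> lies in \<open>K\<close>.\<close>

lemma sine_polar_subset_cball:
  fixes K :: "'a::euclidean_space set"
  assumes "DIM('a) \<ge> 2" "0 < r" "cball 0 r \<subseteq> K"
  shows "sine_polar K \<subseteq> cball 0 (1 / r)"
proof
  fix x assume x: "x \<in> sine_polar K"
  obtain v where v: "x \<bullet> v = 0" "norm v = 1"
    using exists_orthogonal_unit[OF assms(1)] by blast
  have "r *\<^sub>R v \<in> K"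
    using assms v by (intro subsetD[OF assms(3)]) auto
  with x have "sine_bracket x (r *\<^sub>R v) \<le> 1"
    by (auto simp: in_sine_polar_iff)
  then show "x \<in> cball 0 (1 / r)"
    using v assms(2) by (simp add: sine_bracket_orthogonal field_simps)
qed

lemma cball_subset_sine_polar:
  assumes "0 < r" "K \<subseteq> cball 0 r"
  shows "cball 0 (1 / r) \<subseteq> sine_polar K"
proof
  fix x :: 'a assume x: "x \<in> cball 0 (1 / r)"
  show "x \<in> sine_polar K"
    unfolding in_sine_polar_iff
  proof
    fix y assume "y \<in> K"
    then have "norm y \<le> r" using assms by auto
    moreover have "norm x \<le> 1 / r" using x by auto
    ultimately have "norm x * norm y \<le> (1 / r) * r"
      using assms by (intro mult_mono) auto
    then show "sine_bracket x y \<le> 1"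
      using sine_bracket_le[of x y] assms by simp
  qed
qed

lemma sine_polar_cball:
  assumes "DIM('a) \<ge> 2" "0 < r"
  shows "sine_polar (cball (0::'a::euclidean_space) r) = cball 0 (1 / r)"
  by (simp add: assms cball_subset_sine_polar sine_polar_subset_cball subset_antisym)

section \<open>Steiner symmetrisation\<close>

text \<open>For convex \<open>K\<close> this is the Steiner symmetral: a chord with end points \<open>y + a u\<close> and \<open>y + b u\<close>, where
  \<open>y\<close> is orthogonal to \<open>u\<close>, is moved to the one with end points \<open>y \<plusminus> ((a - b) / 2) u\<close>.\<close>
definition steiner :: "'a::euclidean_space \<Rightarrow> 'a set \<Rightarrow> 'a set" where
  "steiner u K = {p - ((p + q) \<bullet> u / 2) *\<^sub>R u | p q. p \<in> K \<and> q \<in> K \<and> (\<exists>c. p - q = c *\<^sub>R u)}"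

lemma steinerI:
  assumes "norm u = 1" "y \<bullet> u = 0" "y + a *\<^sub>R u \<in> K" "y + b *\<^sub>R u \<in> K"
  shows "y + ((a - b) / 2) *\<^sub>R u \<in> steiner u K"
proof -
  have uu: "u \<bullet> u = 1"
    using assms(1) by (simp add: power2_norm_eq_inner[symmetric])
  have "y + ((a - b) / 2) *\<^sub>R u
      = (y + a *\<^sub>R u) - (((y + a *\<^sub>R u) + (y + b *\<^sub>R u)) \<bullet> u / 2) *\<^sub>R u"
    by (simp add: inner_add_left uu assms(2) algebra_simps add_divide_distrib diff_divide_distrib)
      (simp flip: scaleR_add_left)
  moreover have "(y + a *\<^sub>R u) - (y + b *\<^sub>R u) = (a - b) *\<^sub>R u"
    by (simp add: algebra_simps)
  ultimately show ?thesis
    unfolding steiner_def using assms(3,4) by blast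
qed

lemma steinerE:
  assumes "w \<in> steiner u K" "norm u = 1"
  obtains y a b where "y \<bullet> u = 0" "y + a *\<^sub>R u \<in> K" "y + b *\<^sub>R u \<in> K"
    "w = y + ((a - b) / 2) *\<^sub>R u"
proof -
  have uu: "u \<bullet> u = 1"
    using assms(2) by (simp add: power2_norm_eq_inner[symmetric])
  obtain p q c where pq: "p \<in> K" "q \<in> K" "p - q = c *\<^sub>R u"
    and w: "w = p - ((p + q) \<bullet> u / 2) *\<^sub>R u"
    using assms(1) by (auto simp: steiner_def)
  have c: "c = p \<bullet> u - q \<bullet> u"
    using arg_cong[OF pq(3), of "\<lambda>x. x \<bullet> u"] by (simp add: uu inner_diff_left)
  define y where "y = p - (p \<bullet> u) *\<^sub>R u"
  have "q = p - c *\<^sub>R u"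
    using pq(3) by (simp add: algebra_simps)
  then have "y + (q \<bullet> u) *\<^sub>R u = q"
    by (simp add: y_def c algebra_simps)
  moreover have "w = y + ((p \<bullet> u - q \<bullet> u) / 2) *\<^sub>R u"
    by (simp add: w y_def inner_add_left algebra_simps add_divide_distrib diff_divide_distrib)
      (simp flip: scaleR_add_left)
  ultimately show ?thesis
    using that[of y "p \<bullet> u" "q \<bullet> u"] pq by (simp add: y_def inner_diff_left uu)
qed

lemma steiner_subset_sine_polar:
  assumes u: "norm u = 1" and KL: "K \<subseteq> sine_polar L"
  shows "steiner u K \<subseteq> sine_polar (steiner u L)"
  unfolding subset_sine_polar_iff
proof (intro ballI)
  fix v w assume v: "v \<in> steiner u L" and w: "w \<in> steiner u K"
  obtain x c d where x: "x \<bullet> u = 0" "x + c *\<^sub>R u \<in> L" "x + d *\<^sub>R u \<in> L"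
    and v_eq: "v = x + ((c - d) / 2) *\<^sub>R u"
    using steinerE[OF v u] by metis
  obtain y a b where y: "y \<bullet> u = 0" "y + a *\<^sub>R u \<in> K" "y + b *\<^sub>R u \<in> K"
    and w_eq: "w = y + ((a - b) / 2) *\<^sub>R u"
    using steinerE[OF w u] by metis
  \<comment> \<open>The splitting formula turns the two given constraints into bounds for
    \<open>P\<close> and \<open>Q\<close>. For the symmetrised points it has
    \<open>(1 / 2) *\<^sub>R (P - Q)\<close> in their place, so convexity of the squared norm
    suffices.\<close>
  define P where "P = c *\<^sub>R y - a *\<^sub>R x"
  define Q where "Q = d *\<^sub>R y - b *\<^sub>R x"
  have "(sine_bracket (x + c *\<^sub>R u) (y + a *\<^sub>R u))\<^sup>2 \<le> 1"
    "(sine_bracket (x + d *\<^sub>R u) (y + b *\<^sub>R u))\<^sup>2 \<le> 1"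
    using KL x y unfolding subset_sine_polar_iff by (auto simp: power_le_one)
  then have PQ: "(sine_bracket x y)\<^sup>2 + (norm P)\<^sup>2 \<le> 1" "(sine_bracket x y)\<^sup>2 + (norm Q)\<^sup>2 \<le> 1"
    using sine_bracket_split_square[OF u x(1) y(1)] by (auto simp: P_def Q_def)
  have "((c - d) / 2) *\<^sub>R y - ((a - b) / 2) *\<^sub>R x = (1 / 2) *\<^sub>R (P - Q)"
    by (simp add: P_def Q_def algebra_simps diff_divide_distrib)
  then have "(sine_bracket v w)\<^sup>2 = (sine_bracket x y)\<^sup>2 + (norm (P - Q))\<^sup>2 / 4"
    unfolding v_eq w_eq sine_bracket_split_square[OF u x(1) y(1)]
    by (simp add: power2_eq_square)
  also have "(norm (P - Q))\<^sup>2 \<le> 2 * (norm P)\<^sup>2 + 2 * (norm Q)\<^sup>2"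
  proof -
    have "0 \<le> (norm (P + Q))\<^sup>2" by simp
    then show ?thesis
      unfolding power2_norm_eq_inner by (simp add: inner_add inner_diff inner_commute)
  qed
  finally have "(sine_bracket v w)\<^sup>2 \<le> (sine_bracket x y)\<^sup>2 + (2 * (norm P)\<^sup>2 + 2 * (norm Q)\<^sup>2) / 4"
    by simp
  moreover have "X \<le> 1" if "A + p \<le> 1" "A + q \<le> 1" "X \<le> A + (2 * p + 2 * q) / 4" for A p q X :: real
    using that by (simp add: field_simps)
  ultimately have "(sine_bracket v w)\<^sup>2 \<le> 1"
    using PQ by blast
  then show "sine_bracket v w \<le> 1"
    by (simp add: abs_square_le_1)
qed

lemma compact_steiner:
  assumes "norm u = 1" "compact K"
  shows "compact (steiner u K)"
proof -
  have uu: "u \<bullet> u = 1"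
    using assms(1) by (simp add: power2_norm_eq_inner[symmetric])
  \<comment> \<open>Fixing the coefficient of \<open>u\<close> as the inner product of the
    difference with \<open>u\<close>, instead of asking for some \<open>c\<close>, makes the
    condition an equation between continuous functions, hence closed.\<close>
  let ?D = "(K \<times> K) \<inter> {z. fst z - snd z = ((fst z - snd z) \<bullet> u) *\<^sub>R u}"
  let ?f = "\<lambda>z. fst z - ((fst z + snd z) \<bullet> u / 2) *\<^sub>R u"
  have "closed {z::'a \<times> 'a. fst z - snd z = ((fst z - snd z) \<bullet> u) *\<^sub>R u}"
    by (intro closed_Collect_eq continuous_intros)
  then have "compact ?D"
    using assms(2) by (intro compact_Int_closed compact_Times) auto
  moreover have "continuous_on ?D ?f"
    by (intro continuous_intros) auto
  ultimately have "compact (?f ` ?D)"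
    using compact_continuous_image by blast
  moreover have "?f ` ?D = steiner u K"
  proof -
    have "(\<exists>c. p - q = c *\<^sub>R u) \<longleftrightarrow> p - q = ((p - q) \<bullet> u) *\<^sub>R u" for p q
      using uu by (metis inner_scaleR_left mult.right_neutral)
    then have "steiner u K = {?f (p, q) | p q. (p, q) \<in> ?D}"
      by (simp only: steiner_def fst_conv snd_conv mem_Times_iff Int_iff mem_Collect_eq conj_assoc)
    also have "\<dots> = ?f ` ?D"
      by blast
    finally show ?thesis by simp
  qed
  ultimately show ?thesis by simp
qed

lemma norm_split_square:
  assumes "norm u = 1" "y \<bullet> u = 0"
  shows "(norm (y + s *\<^sub>R u))\<^sup>2 = (norm y)\<^sup>2 + s\<^sup>2"
  using assms norm_add_Pythagorean[of y "s *\<^sub>R u"] by (simp add: orthogonal_def)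

text \<open>A point of the ball and its mirror image in the hyperplane orthogonal to
  \<open>u\<close> both lie in \<open>K\<close>, and symmetrising this pair returns the
  point.\<close>

lemma cball_subset_steiner:
  fixes u :: "'a::euclidean_space"
  assumes u: "norm u = 1" and K: "cball 0 r \<subseteq> K"
  shows "cball 0 r \<subseteq> steiner u K"
proof
  fix w :: 'a assume w: "w \<in> cball 0 r"
  have uu: "u \<bullet> u = 1"
    using u by (simp add: power2_norm_eq_inner[symmetric])
  define s y where "s = w \<bullet> u" and "y = w - s *\<^sub>R u"
  have y: "y \<bullet> u = 0"
    by (simp add: y_def s_def inner_diff_left uu)
  have "(norm (y + (- s) *\<^sub>R u))\<^sup>2 = (norm (y + s *\<^sub>R u))\<^sup>2"
    unfolding norm_split_square[OF u y] by simp
  then have "norm (y + (- s) *\<^sub>R u) = norm w"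
    by (simp add: y_def)
  then have "y + (- s) *\<^sub>R u \<in> K" "y + s *\<^sub>R u \<in> K"
    using w K by (auto simp: y_def subset_iff)
  from steinerI[OF u y this(2,1)] show "w \<in> steiner u K"
    by (simp add: y_def)
qed

lemma steiner_subset_cball:
  assumes u: "norm u = 1" and K: "K \<subseteq> cball 0 r"
  shows "steiner u K \<subseteq> cball 0 r"
proof
  fix w assume "w \<in> steiner u K"
  then obtain y a b where y: "y \<bullet> u = 0" "y + a *\<^sub>R u \<in> K" "y + b *\<^sub>R u \<in> K"
    and w: "w = y + ((a - b) / 2) *\<^sub>R u"
    using steinerE[OF _ u] by metis
  have r: "norm (y + a *\<^sub>R u) \<le> r" "norm (y + b *\<^sub>R u) \<le> r"
    using y K by auto
  then have "0 \<le> r"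
    using norm_ge_zero order_trans by blast
  from r have "(norm (y + a *\<^sub>R u))\<^sup>2 \<le> r\<^sup>2" "(norm (y + b *\<^sub>R u))\<^sup>2 \<le> r\<^sup>2"
    by (auto intro!: power_mono)
  then have "(norm y)\<^sup>2 + a\<^sup>2 \<le> r\<^sup>2" "(norm y)\<^sup>2 + b\<^sup>2 \<le> r\<^sup>2"
    unfolding norm_split_square[OF u y(1)] .
  moreover have "((a - b) / 2)\<^sup>2 \<le> (a\<^sup>2 + b\<^sup>2) / 2"
    using zero_le_power2[of "a + b"] by (simp add: power2_eq_square field_simps)
  ultimately have "(norm w)\<^sup>2 \<le> r\<^sup>2"
    unfolding w norm_split_square[OF u y(1)] by (simp add: field_simps)
  then show "w \<in> cball 0 r"
    using \<open>0 \<le> r\<close> power2_le_imp_le[of "norm w" r] by simp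
qed

section \<open>Volume under symmetrisation\<close>

text \<open>A version of Fubini's theorem along an arbitrary direction \<open>u\<close> that does not require a
  product decomposition of the space: lines are averaged over a slab of width one.\<close>
lemma emeasure_lborel_slab:
  fixes K :: "'a::euclidean_space set"
  assumes u: "norm u = 1" and K[measurable]: "K \<in> sets borel"
  shows "emeasure lborel K
    = (\<integral>\<^sup>+x. indicator {0..1} (x \<bullet> u) * emeasure lborel {s. x + s *\<^sub>R u \<in> K} \<partial>lborel)"
proof -
  have uu: "u \<bullet> u = 1"
    using u by (simp add: power2_norm_eq_inner[symmetric])
  let ?I = "indicator {0..1::real} :: real \<Rightarrow> ennreal"
  have "(\<integral>\<^sup>+x. ?I (x \<bullet> u) * emeasure lborel {s. x + s *\<^sub>R u \<in> K} \<partial>lborel)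
      = (\<integral>\<^sup>+x. (\<integral>\<^sup>+s. ?I (x \<bullet> u) * indicator K (x + s *\<^sub>R u) \<partial>lborel) \<partial>lborel)"
  proof (rule nn_integral_cong)
    fix x :: 'a
    have "emeasure lborel {s. x + s *\<^sub>R u \<in> K} = (\<integral>\<^sup>+s. indicator {s. x + s *\<^sub>R u \<in> K} s \<partial>lborel)"
      by (subst nn_integral_indicator) measurable
    also have "\<dots> = (\<integral>\<^sup>+s. indicator K (x + s *\<^sub>R u) \<partial>lborel)"
      by (intro nn_integral_cong) (auto simp: indicator_def)
    finally show "?I (x \<bullet> u) * emeasure lborel {s. x + s *\<^sub>R u \<in> K}
        = (\<integral>\<^sup>+s. ?I (x \<bullet> u) * indicator K (x + s *\<^sub>R u) \<partial>lborel)"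
      by (subst nn_integral_cmult) (auto, measurable)
  qed
  also have "\<dots> = (\<integral>\<^sup>+s. (\<integral>\<^sup>+x. ?I (x \<bullet> u) * indicator K (x + s *\<^sub>R u) \<partial>lborel) \<partial>lborel)"
    by (rule lborel_pair.Fubini'[symmetric]) measurable
  \<comment> \<open>Translating \<open>x\<close> by \<open>s *\<^sub>R u\<close> moves the
    dependence on \<open>s\<close> from \<open>K\<close> to the slab. Integrating over
    \<open>s\<close> first then gives the length of a unit interval.\<close>
  also have "\<dots> = (\<integral>\<^sup>+s. (\<integral>\<^sup>+x. ?I (x \<bullet> u - s) * indicator K x \<partial>lborel) \<partial>lborel)"
  proof (rule nn_integral_cong)
    fix s :: real
    have "(\<integral>\<^sup>+x. ?I (x \<bullet> u - s) * indicator K x \<partial>lborel)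
        = (\<integral>\<^sup>+x. ?I (x \<bullet> u - s) * indicator K x \<partial>distr lborel borel ((+) (s *\<^sub>R u)))"
      by (simp add: lborel_distr_plus)
    also have "\<dots> = (\<integral>\<^sup>+x. ?I (x \<bullet> u) * indicator K (x + s *\<^sub>R u) \<partial>lborel)"
      by (subst nn_integral_distr) (auto simp: inner_add_left uu add.commute)
    finally show "(\<integral>\<^sup>+x. ?I (x \<bullet> u) * indicator K (x + s *\<^sub>R u) \<partial>lborel)
        = (\<integral>\<^sup>+x. ?I (x \<bullet> u - s) * indicator K x \<partial>lborel)" by simp
  qed
  also have "\<dots> = (\<integral>\<^sup>+x. (\<integral>\<^sup>+s. ?I (x \<bullet> u - s) * indicator K x \<partial>lborel) \<partial>lborel)"
    by (rule lborel_pair.Fubini') measurable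
  also have "\<dots> = (\<integral>\<^sup>+x. indicator K x \<partial>lborel)"
  proof (rule nn_integral_cong)
    fix x :: 'a
    have "(\<integral>\<^sup>+s. ?I (x \<bullet> u - s) \<partial>lborel) = (\<integral>\<^sup>+s. indicator {x \<bullet> u - 1..x \<bullet> u} s \<partial>lborel)"
      by (intro nn_integral_cong) (auto simp: indicator_def)
    then show "(\<integral>\<^sup>+s. ?I (x \<bullet> u - s) * indicator K x \<partial>lborel) = indicator K x"
      by (subst nn_integral_multc) auto
  qed
  finally show ?thesis
    by simp
qed

text \<open>By the slab formula it suffices to compare single lines. By convexity a line meets
  \<open>K\<close> in an interval, and the symmetral contains an interval of the same length on that
  line.\<close>

lemma emeasure_le_steiner:
  fixes K :: "'a::euclidean_space set"
  assumes u: "norm u = 1" and K: "compact K" "convex K"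
  shows "emeasure lborel K \<le> emeasure lborel (steiner u K)"
proof -
  have uu: "u \<bullet> u = 1"
    using u by (simp add: power2_norm_eq_inner[symmetric])
  have meas: "K \<in> sets borel" "steiner u K \<in> sets borel"
    using K compact_steiner[OF u] by (auto intro: borel_closed compact_imp_closed)
  have "emeasure lborel {s. x + s *\<^sub>R u \<in> K} \<le> emeasure lborel {s. x + s *\<^sub>R u \<in> steiner u K}" for x
  proof (cases "{s. x + s *\<^sub>R u \<in> K} = {}")
    case False
    let ?S = "{s. x + s *\<^sub>R u \<in> K}"
    have "closed ?S"
    proof -
      have "closed ((\<lambda>s. x + s *\<^sub>R u) -` K)"
        by (intro closed_vimage compact_imp_closed K(1) continuous_intros)
      then show ?thesis by (simp add: vimage_def)
    qed
    moreover have "bounded ?S"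
    proof -
      obtain B where B: "\<And>y. y \<in> K \<Longrightarrow> norm y \<le> B"
        using compact_imp_bounded[OF K(1)] bounded_iff by blast
      have "norm s \<le> B + norm x" if "s \<in> ?S" for s
        using B[of "x + s *\<^sub>R u"] that norm_triangle_ineq4[of "x + s *\<^sub>R u" x] u by simp
      then show ?thesis
        unfolding bounded_iff by blast
    qed
    moreover have "convex ?S"
    proof (rule convexI)
      fix s t a b :: real assume st: "s \<in> ?S" "t \<in> ?S" "0 \<le> a" "0 \<le> b" "a + b = 1"
      have "a *\<^sub>R (x + s *\<^sub>R u) + b *\<^sub>R (x + t *\<^sub>R u) \<in> K"
        using st K(2) by (intro convexD) auto
      moreover have "a *\<^sub>R (x + s *\<^sub>R u) + b *\<^sub>R (x + t *\<^sub>R u) = x + (a *\<^sub>R s + b *\<^sub>R t) *\<^sub>R u"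
        using st(5) by (simp add: algebra_simps) (metis scaleR_add_left scaleR_one)
      ultimately show "a *\<^sub>R s + b *\<^sub>R t \<in> ?S"
        by simp
    qed
    ultimately obtain a b where ab: "?S = {a..b}"
      by (metis connected_compact_interval_1 compact_eq_bounded_closed convex_connected)
    with False have "a \<le> b" by auto
    define k where "k = x \<bullet> u"
    have "x - k *\<^sub>R u + s *\<^sub>R u \<in> K \<longleftrightarrow> a \<le> s - k \<and> s - k \<le> b" for s
    proof -
      have "x - k *\<^sub>R u + s *\<^sub>R u = x + (s - k) *\<^sub>R u"
        by (simp add: algebra_simps)
      then have "x - k *\<^sub>R u + s *\<^sub>R u \<in> K \<longleftrightarrow> s - k \<in> ?S"
        by (metis mem_Collect_eq)
      then show ?thesis
        unfolding ab by simp
    qed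
    note inK = this
    \<comment> \<open>The two points of \<open>K\<close> are chosen symmetrically about the midpoint
      of the chord, so that half the difference of their parameters is \<open>s + k\<close>.\<close>
    have "x + s *\<^sub>R u \<in> steiner u K" if s: "- k - (b - a) / 2 \<le> s" "s \<le> - k + (b - a) / 2" for s
    proof -
      have "x - k *\<^sub>R u + ((a + b) / 2 + s + 2 * k) *\<^sub>R u \<in> K" "x - k *\<^sub>R u + ((a + b) / 2 - s) *\<^sub>R u \<in> K"
        unfolding inK using s by (auto simp: field_simps)
      moreover have "(x - k *\<^sub>R u) \<bullet> u = 0"
        by (simp add: k_def inner_diff_left uu)
      ultimately have "x - k *\<^sub>R u + (((a + b) / 2 + s + 2 * k - ((a + b) / 2 - s)) / 2) *\<^sub>R u \<in> steiner u K"
        by (intro steinerI[OF u])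
      moreover have "((a + b) / 2 + s + 2 * k - ((a + b) / 2 - s)) / 2 = s + k"
        by (simp add: field_simps)
      ultimately have "x - k *\<^sub>R u + (s + k) *\<^sub>R u \<in> steiner u K"
        by metis
      then show ?thesis
        by (simp add: algebra_simps)
    qed
    then have "{- k - (b - a) / 2..- k + (b - a) / 2} \<subseteq> {s. x + s *\<^sub>R u \<in> steiner u K}"
      by auto
    moreover have "{s. x + s *\<^sub>R u \<in> steiner u K} \<in> sets lborel"
      using meas(2) by measurable
    ultimately have "emeasure lborel {- k - (b - a) / 2..- k + (b - a) / 2}
        \<le> emeasure lborel {s. x + s *\<^sub>R u \<in> steiner u K}"
      by (intro emeasure_mono)
    moreover have "emeasure lborel {- k - (b - a) / 2..- k + (b - a) / 2} = ennreal (b - a)"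
      using \<open>a \<le> b\<close> by (subst emeasure_lborel_Icc) (auto simp: field_simps)
    ultimately show ?thesis
      using \<open>a \<le> b\<close> by (simp add: ab)
  qed simp
  then show ?thesis
    unfolding emeasure_lborel_slab[OF u meas(1)] emeasure_lborel_slab[OF u meas(2)]
    by (intro nn_integral_mono mult_left_mono) auto
qed

lemma measure_le_steiner:
  fixes K :: "'a::euclidean_space set"
  assumes u: "norm u = 1" and K: "compact K" "convex K"
  shows "measure lebesgue K \<le> measure lebesgue (steiner u K)"
proof -
  have c: "compact (steiner u K)"
    using compact_steiner[OF u K(1)] .
  then have "K \<in> sets borel" "steiner u K \<in> sets borel"
    using K by (auto intro: borel_closed compact_imp_closed)
  then have "measure lebesgue K = measure lborel K"
    "measure lebesgue (steiner u K) = measure lborel (steiner u K)"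
    by (auto simp: measure_completion)
  moreover have "emeasure lborel (steiner u K) < \<infinity>"
    using emeasure_compact_finite[OF c] by simp
  ultimately show ?thesis
    using emeasure_le_steiner[OF assms] by (simp add: measure_def enn2real_mono)
qed

section \<open>Maximising pairs\<close>

text \<open>The convex set \<open>D\<close> lies in the closure of its interior. A point of
  \<open>D\<close> outside the closed set \<open>C\<close> therefore makes
  \<open>interior D - C\<close> a nonempty open set, which has positive measure.\<close>

lemma compact_eq_convex_of_measure_le:
  fixes C :: "'a::euclidean_space set"
  assumes C: "compact C" and D: "compact D" "convex D" "interior D \<noteq> {}"
    and CD: "C \<subseteq> D" and le: "measure lebesgue D \<le> measure lebesgue C"
  shows "C = D"
proof (rule ccontr)
  assume "C \<noteq> D"
  then obtain x where x: "x \<in> D" "x \<notin> C"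
    using CD by blast
  define U where "U = interior D - C"
  have "open U"
    using C by (auto simp: U_def intro: open_Diff compact_imp_closed)
  have "x \<in> closure (interior D)"
    using x D closure_subset convex_closure_interior by blast
  moreover have "open (- C)" "x \<in> - C"
    using C x by (auto simp: compact_imp_closed)
  ultimately have "U \<noteq> {}"
    unfolding U_def closure_iff_nhds_not_empty by blast
  have UD: "U \<subseteq> D" "U \<inter> C = {}"
    using interior_subset by (auto simp: U_def)
  have "bounded U"
    using bounded_subset[OF compact_imp_bounded[OF D(1)] UD(1)] .
  then have lm: "C \<in> lmeasurable" "D \<in> lmeasurable" "U \<in> lmeasurable"
    using C D \<open>open U\<close> by (auto intro: lmeasurable_compact lmeasurable_open)
  have "measure lebesgue (C \<union> U) \<le> measure lebesgue D"
    using lm CD UD by (intro measure_mono_fmeasurable) (auto simp: fmeasurableD)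
  moreover have "measure lebesgue (C \<union> U) = measure lebesgue C + measure lebesgue U"
    using lm UD by (intro measure_Un3[THEN trans]) (auto simp: Int_commute)
  ultimately have "measure lebesgue U = 0"
    using le measure_nonneg[of lebesgue U] by linarith
  then show False
    using \<open>open U\<close> \<open>U \<noteq> {}\<close> lm(3) by (metis completion.complete2 lmeasurable_iff_integrable negligible_iff_measure open_not_negligible)
qed

section \<open>Existence of maximising pairs\<close>

text \<open>With the radii \<open>1 / R\<close> and \<open>R\<close> the class is closed under replacing a member of a pair by the sine
  polar of the other one.\<close>
definition sine_class :: "real \<Rightarrow> ('a::euclidean_space set \<times> 'a set) set" where
  "sine_class R = {(K, L). compact K \<and> compact L \<and> cball 0 (1 / R) \<subseteq> K \<and> K \<subseteq> cball 0 R \<and>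
     cball 0 (1 / R) \<subseteq> L \<and> L \<subseteq> cball 0 R \<and> K \<subseteq> sine_polar L}"

text \<open>Mutual polarity can be demanded of a maximiser because replacing a member of a pair by
  the polar of the other one stays in the class and does not decrease the volumes.\<close>

definition sine_maximal :: "real \<Rightarrow> 'a::euclidean_space set \<Rightarrow> 'a set \<Rightarrow> bool" where
  "sine_maximal R K L \<longleftrightarrow> (K, L) \<in> sine_class R \<and> K = sine_polar L \<and> L = sine_polar K \<and>
     (\<forall>(K' :: 'a set, L')\<in>sine_class R.
        measure lebesgue K' * measure lebesgue L' \<le> measure lebesgue K * measure lebesgue L)"

lemma sine_maximalD:
  fixes K :: "'a::euclidean_space set"
  assumes "sine_maximal R K L"
  shows "(K, L) \<in> sine_class R" "sine_polar L = K" "sine_polar K = L"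
    "\<And>K' L' :: 'a set. (K', L') \<in> sine_class R \<Longrightarrow>
      measure lebesgue K' * measure lebesgue L' \<le> measure lebesgue K * measure lebesgue L"
  using assms unfolding sine_maximal_def by blast+

lemma sine_class_measure_pos:
  assumes "(K, L) \<in> sine_class R" "0 < R"
  shows "0 < measure lebesgue K" "0 < measure lebesgue L"
proof -
  have "0 < measure lebesgue S" if "compact S" "cball 0 (1 / R) \<subseteq> S" for S :: "'a set"
  proof -
    have "0 < measure lebesgue (cball (0::'a) (1 / R))"
      using assms(2) content_cball_pos[of "1 / R" "0::'a"] by simp
    also have "\<dots> \<le> measure lebesgue S"
      using that by (intro measure_mono_fmeasurable) (auto simp: lmeasurable_compact)
    finally show ?thesis .
  qed
  then show "0 < measure lebesgue K" "0 < measure lebesgue L"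
    using assms(1) by (auto simp: sine_class_def)
qed

lemma sine_polar_mem_sine_class:
  fixes K L :: "'a::euclidean_space set"
  assumes "DIM('a) \<ge> 2" "0 < R" "compact L" "cball 0 (1 / R) \<subseteq> L" "L \<subseteq> cball 0 R"
  shows "(sine_polar L, L) \<in> sine_class R"
proof -
  have "sine_polar L \<subseteq> cball 0 R"
    using sine_polar_subset_cball[of "1 / R" L] assms by simp
  moreover have "cball 0 (1 / R) \<subseteq> sine_polar L"
    using cball_subset_sine_polar assms by blast
  ultimately show ?thesis
    using assms bounded_subset[OF bounded_cball]
    by (auto simp: sine_class_def compact_eq_bounded_closed closed_sine_polar)
qed

lemma sine_class_swap: "(K, L) \<in> sine_class R \<longleftrightarrow> (L, K) \<in> sine_class R"
  using subset_sine_polar_swap by (auto simp: sine_class_def)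

text \<open>This is Blaschke selection in terms of distance functions: those of a maximising
  sequence are equi-Lipschitz, so by Arzela-Ascoli a subsequence converges uniformly, and the zero
  sets of the limit give a maximising pair.\<close>

lemma exists_sine_maximal:
  assumes dim: "DIM('a::euclidean_space) \<ge> 2" and R: "1 \<le> R"
  obtains K L :: "'a::euclidean_space set" where "sine_maximal R K L"
proof -
  let ?\<mu> = "measure (lebesgue :: 'a measure)"
  let ?B = "cball (0::'a) R"
  have R0: "0 < R" "1 / R \<le> R"
    using R mult_mono[of 1 R 1 R] by (auto simp: divide_le_eq)
  have mono: "?\<mu> S \<le> ?\<mu> T" if "compact S" "compact T" "S \<subseteq> T" for S T
    using that by (intro measure_mono_fmeasurable) (auto simp: lmeasurable_compact fmeasurableD)
  define P where "P = (\<lambda>(K, L). ?\<mu> K * ?\<mu> L) ` sine_class R"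
  have "(sine_polar (cball 0 1), cball 0 1) \<in> (sine_class R :: ('a set \<times> 'a set) set)"
    using R R0 dim by (intro sine_polar_mem_sine_class subset_cball) auto
  then have "P \<noteq> {}"
    by (auto simp: P_def)
  have "bdd_above P"
  proof (rule bdd_aboveI)
    fix z assume "z \<in> P"
    then obtain K L where z: "z = ?\<mu> K * ?\<mu> L" and KL: "(K, L) \<in> sine_class R"
      by (auto simp: P_def)
    show "z \<le> ?\<mu> ?B * ?\<mu> ?B"
      unfolding z using KL by (intro mult_mono mono) (auto simp: sine_class_def)
  qed
  define m where "m = Sup P"
  have "\<exists>Z. Z \<in> sine_class R \<and> m - 1 / real (Suc n) < ?\<mu> (fst Z) * ?\<mu> (snd Z)" for n
  proof -
    have "m - 1 / real (Suc n) < Sup P"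
      by (simp add: m_def)
    then obtain z where "z \<in> P" "m - 1 / real (Suc n) < z"
      using less_cSup_iff[OF \<open>P \<noteq> {}\<close> \<open>bdd_above P\<close>] by blast
    then show ?thesis
      by (force simp: P_def)
  qed
  then obtain Z where Z: "\<And>n. Z n \<in> sine_class R"
    "\<And>n. m - 1 / real (Suc n) < ?\<mu> (fst (Z n)) * ?\<mu> (snd (Z n))"
    by metis
  define K where "K n = fst (Z n)" for n
  define L where "L n = snd (Z n)" for n
  have KL: "(K n, L n) \<in> sine_class R" "m - 1 / real (Suc n) < ?\<mu> (K n) * ?\<mu> (L n)" for n
    using Z[of n] by (auto simp: K_def L_def)
  have K: "compact (K n)" "cball 0 (1 / R) \<subseteq> K n" "K n \<subseteq> ?B" "0 \<in> K n"
    and L: "compact (L n)" "cball 0 (1 / R) \<subseteq> L n" "L n \<subseteq> ?B" "0 \<in> L n"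
    and KL1: "\<And>x y. x \<in> K n \<Longrightarrow> y \<in> L n \<Longrightarrow> sine_bracket x y \<le> 1" for n
    using KL(1)[of n] R0 by (auto simp: sine_class_def subset_iff in_sine_polar_iff)
  define F where "F n x = (infdist x (K n), infdist x (L n))" for n x
  obtain g k where g: "continuous_on ?B g" and "strict_mono (k :: nat \<Rightarrow> nat)"
    and lim: "\<And>e. 0 < e \<Longrightarrow> \<exists>N. \<forall>n x. n \<ge> N \<and> x \<in> ?B \<longrightarrow> norm (F (k n) x - g x) < e"
  proof (rule Arzela_Ascoli[of ?B F "2 * R"])
    fix n x assume x: "x \<in> ?B"
    have "infdist x (K n) \<le> R" "infdist x (L n) \<le> R"
      using infdist_le[OF K(4)[of n], of x] infdist_le[OF L(4)[of n], of x] x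
      by (auto simp: dist_commute)
    then show "norm (F n x) \<le> 2 * R"
      using norm_Pair_le[of "infdist x (K n)" "infdist x (L n)"]
      by (simp add: F_def infdist_nonneg)
  next
    fix x e assume "x \<in> ?B" "(0::real) < e"
    have "norm (F n x - F n y) < e" if "norm (x - y) < e / 2" for n y
    proof -
      have "\<bar>infdist x (K n) - infdist y (K n)\<bar> \<le> dist x y"
        "\<bar>infdist x (L n) - infdist y (L n)\<bar> \<le> dist x y"
        by (rule infdist_triangle_abs)+
      then show ?thesis
        using norm_Pair_le[of "infdist x (K n) - infdist y (K n)" "infdist x (L n) - infdist y (L n)"] that
        by (simp add: F_def dist_norm)
    qed
    then show "\<exists>d. 0 < d \<and> (\<forall>n y. y \<in> ?B \<and> norm (x - y) < d \<longrightarrow> norm (F n x - F n y) < e)"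
      using \<open>0 < e\<close> by (intro exI[of _ "e / 2"]) auto
  qed auto
  have limK: "\<exists>N. \<forall>n x. n \<ge> N \<and> x \<in> ?B \<longrightarrow>
      \<bar>infdist x (K (k n)) - fst (g x)\<bar> < e \<and> \<bar>infdist x (L (k n)) - snd (g x)\<bar> < e" if e: "0 < e" for e
  proof -
    obtain N where N: "\<And>n x. n \<ge> N \<Longrightarrow> x \<in> ?B \<Longrightarrow> norm (F (k n) x - g x) < e"
      using lim[OF e] by blast
    have "\<bar>infdist x (K (k n)) - fst (g x)\<bar> < e \<and> \<bar>infdist x (L (k n)) - snd (g x)\<bar> < e"
      if "n \<ge> N" "x \<in> ?B" for n x
    proof -
      obtain a b where ab: "g x = (a, b)" by fastforce
      show ?thesis
        using N[OF that] norm_fst_le[of "infdist x (K (k n)) - a" "infdist x (L (k n)) - b"]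
          norm_snd_le[of "infdist x (L (k n)) - b" "infdist x (K (k n)) - a"]
        by (simp add: F_def ab)
    qed
    then show ?thesis by blast
  qed
  \<comment> \<open>The sublevel sets at level \<open>0\<close> are the limit bodies, while those at
    a positive level contain all late members of the subsequence. Letting the level decrease to
    \<open>0\<close> gives upper semicontinuity of the volume.\<close>
  define A where "A e = {x \<in> ?B. fst (g x) \<le> e}" for e
  define B where "B e = {x \<in> ?B. snd (g x) \<le> e}" for e
  have comp: "compact (A e)" "compact (B e)" for e
  proof -
    have "closed (A e)" "closed (B e)"
      unfolding A_def B_def
      by (intro continuous_on_closed_Collect_le continuous_intros g; simp)+
    moreover have "A e \<subseteq> ?B" "B e \<subseteq> ?B"
      by (auto simp: A_def B_def)
    ultimately show "compact (A e)" "compact (B e)"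
      by (metis bounded_cball bounded_subset compact_eq_bounded_closed)+
  qed
  have "cball 0 (1 / R) \<subseteq> B 0" "cball 0 (1 / R) \<subseteq> A 0"
  proof -
    have "fst (g x) \<le> 0 \<and> snd (g x) \<le> 0" if "x \<in> cball 0 (1 / R)" for x
    proof -
      have "x \<in> K n" "x \<in> L n" for n
        using that K(2)[of n] L(2)[of n] by auto
      then have 0: "infdist x (K n) = 0" "infdist x (L n) = 0" for n
        by simp_all
      have "x \<in> ?B"
        using that R0 by auto
      then have "\<bar>fst (g x)\<bar> < e \<and> \<bar>snd (g x)\<bar> < e" if "0 < e" for e
        using limK[OF that] 0 by fastforce
      then have "fst (g x) \<le> 0 + e \<and> snd (g x) \<le> 0 + e" if "0 < e" for e
        using that by fastforce
      then show ?thesis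
        using field_le_epsilon by blast
    qed
    moreover have "cball 0 (1 / R) \<subseteq> ?B"
      using R0 by auto
    ultimately show "cball 0 (1 / R) \<subseteq> B 0" "cball 0 (1 / R) \<subseteq> A 0"
      by (auto simp: A_def B_def)
  qed
  note cb = this
  have AB: "sine_bracket x y \<le> 1" if "x \<in> A 0" "y \<in> B 0" for x y
  proof (rule field_le_epsilon)
    fix e :: real assume "0 < e"
    \<comment> \<open>Replacing \<open>x\<close> and \<open>y\<close> by nearest points of
      \<open>K (k n)\<close> and \<open>L (k n)\<close> costs at most \<open>d * R\<close> each,
      which adds up to \<open>e\<close>.\<close>
    define d where "d = e / (2 * R)"
    have "0 < d"
      using \<open>0 < e\<close> R0 by (simp add: d_def)
    have xy: "x \<in> ?B" "y \<in> ?B" "fst (g x) \<le> 0" "snd (g y) \<le> 0"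
      using that by (auto simp: A_def B_def)
    obtain n where "\<bar>infdist x (K (k n)) - fst (g x)\<bar> < d" "\<bar>infdist y (L (k n)) - snd (g y)\<bar> < d"
      using limK[OF \<open>0 < d\<close>] xy by blast
    then have n: "infdist x (K (k n)) < d" "infdist y (L (k n)) < d"
      using xy by linarith+
    obtain x' where x': "x' \<in> K (k n)" "infdist x (K (k n)) = dist x x'"
      using infdist_attains_inf[of "K (k n)" x] K[of "k n"] by (metis compact_imp_closed empty_iff)
    obtain y' where y': "y' \<in> L (k n)" "infdist y (L (k n)) = dist y y'"
      using infdist_attains_inf[of "L (k n)" y] L[of "k n"] by (metis compact_imp_closed empty_iff)
    have "sine_bracket x y \<le> sine_bracket x y' + sine_bracket x (y - y')"
      using sine_bracket_triangle[of x y' "y - y'"] by simp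
    also have "sine_bracket x y' \<le> sine_bracket x' y' + sine_bracket (x - x') y'"
      using sine_bracket_triangle[of y' x' "x - x'"] by (simp add: sine_bracket_commute)
    also have "sine_bracket x' y' \<le> 1"
      using KL1 x' y' by blast
    also have "sine_bracket (x - x') y' \<le> d * R"
      using n x' y' L(3)[of "k n"] \<open>0 < d\<close>
      by (intro order_trans[OF sine_bracket_le] mult_mono) (auto simp: dist_norm)
    also have "sine_bracket x (y - y') \<le> R * d"
      using n y' xy R0 by (intro order_trans[OF sine_bracket_le] mult_mono) (auto simp: dist_norm)
    finally show "sine_bracket x y \<le> 1 + e"
      using R0 by (simp add: d_def)
  qed
  have m_le: "m \<le> ?\<mu> (A e) * ?\<mu> (B e)" if e: "0 < e" for e
  proof (rule field_le_epsilon)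
    fix d :: real assume "0 < d"
    obtain N where N: "\<And>n x. n \<ge> N \<Longrightarrow> x \<in> ?B \<Longrightarrow>
      \<bar>infdist x (K (k n)) - fst (g x)\<bar> < e \<and> \<bar>infdist x (L (k n)) - snd (g x)\<bar> < e"
      using limK[OF e] by blast
    obtain N' where N': "1 / real (Suc N') < d"
      using \<open>0 < d\<close> by (metis nat_approx_posE)
    define n where "n = max N N'"
    have "K (k n) \<subseteq> A e" "L (k n) \<subseteq> B e"
    proof -
      have "fst (g x) \<le> e" if "x \<in> K (k n)" for x
      proof -
        have "infdist x (K (k n)) = 0" "x \<in> ?B"
          using that K(3)[of "k n"] by auto
        then show ?thesis
          using N[of n x] by (simp add: n_def abs_less_iff)
      qed
      then show "K (k n) \<subseteq> A e"
        using K(3)[of "k n"] by (auto simp: A_def)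
      have "snd (g x) \<le> e" if "x \<in> L (k n)" for x
      proof -
        have "infdist x (L (k n)) = 0" "x \<in> ?B"
          using that L(3)[of "k n"] by auto
        then show ?thesis
          using N[of n x] by (simp add: n_def abs_less_iff)
      qed
      then show "L (k n) \<subseteq> B e"
        using L(3)[of "k n"] by (auto simp: B_def)
    qed
    then have "?\<mu> (K (k n)) * ?\<mu> (L (k n)) \<le> ?\<mu> (A e) * ?\<mu> (B e)"
      using K L comp by (intro mult_mono mono) auto
    moreover have "1 / real (Suc (k n)) \<le> 1 / real (Suc N')"
    proof -
      have "N' \<le> k n"
        using seq_suble[OF \<open>strict_mono k\<close>, of n] by (simp add: n_def)
      then show ?thesis
        by (intro divide_left_mono) auto
    qed
    ultimately show "m \<le> ?\<mu> (A e) * ?\<mu> (B e) + d"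
      using KL(2)[of "k n"] N' by linarith
  qed
  define e where "e n = 1 / real (Suc n)" for n
  have e: "0 < e n" for n
    by (simp add: e_def)
  have "e \<longlonglongrightarrow> 0"
    unfolding e_def using LIMSEQ_inverse_real_of_nat by (simp add: inverse_eq_divide)
  have "decseq e"
    by (auto simp: decseq_def e_def field_simps)
  have lim: "(\<lambda>n. ?\<mu> (C (e n))) \<longlonglongrightarrow> ?\<mu> (C 0)"
    if "\<And>e. compact (C e)" and C: "\<And>e. C e = {x \<in> ?B. h x \<le> e}" for C h
  proof -
    have "(\<lambda>n. ?\<mu> (C (e n))) \<longlonglongrightarrow> ?\<mu> (\<Inter>n. C (e n))"
    proof (rule Lim_measure_decseq)
      show "range (\<lambda>n. C (e n)) \<subseteq> sets lebesgue"
        using lmeasurable_compact[OF that(1)] fmeasurableD by blast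
      show "decseq (\<lambda>n. C (e n))"
        using \<open>decseq e\<close> unfolding C decseq_def by (auto intro: order_trans)
      show "emeasure lebesgue (C (e n)) \<noteq> \<infinity>" for n
        using fmeasurableD2[OF lmeasurable_compact[OF that(1)]] by (simp only: infinity_ennreal_def not_False_eq_True)
    qed
    moreover have "(\<Inter>n. C (e n)) = C 0"
    proof -
      have "h x \<le> 0" if "\<And>n. h x \<le> e n" for x
        using LIMSEQ_le_const[OF \<open>e \<longlonglongrightarrow> 0\<close>] that by blast
      moreover have "h x \<le> e n" if "h x \<le> 0" for x n
        using that e[of n] by linarith
      ultimately show ?thesis
        unfolding C by auto
    qed
    ultimately show ?thesis by simp
  qed
  have "(\<lambda>n. ?\<mu> (A (e n)) * ?\<mu> (B (e n))) \<longlonglongrightarrow> ?\<mu> (A 0) * ?\<mu> (B 0)"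
    by (intro tendsto_mult lim[OF comp(1) A_def] lim[OF comp(2) B_def])
  then have m0: "m \<le> ?\<mu> (A 0) * ?\<mu> (B 0)"
    by (rule LIMSEQ_le_const) (use m_le e in blast)
  \<comment> \<open>Taking polars twice enlarges the limit pair to a mutually polar pair within the
    class.\<close>
  define K0 where "K0 = sine_polar (B 0)"
  define L0 where "L0 = sine_polar K0"
  have sub: "A 0 \<subseteq> K0" "B 0 \<subseteq> L0"
    using AB subset_sine_polar_sine_polar by (auto simp: K0_def L0_def in_sine_polar_iff)
  have "(K0, B 0) \<in> sine_class R"
    unfolding K0_def using comp cb R0 dim by (intro sine_polar_mem_sine_class) (auto simp: B_def)
  then have "(L0, K0) \<in> sine_class R"
    unfolding L0_def using R0 dim by (intro sine_polar_mem_sine_class) (auto simp: sine_class_def)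
  then have KL0: "(K0, L0) \<in> sine_class R"
    using sine_class_swap by blast
  have "?\<mu> (A 0) * ?\<mu> (B 0) \<le> ?\<mu> K0 * ?\<mu> L0"
    using sub comp KL0 by (intro mult_mono mono) (auto simp: sine_class_def)
  with m0 have m_le0: "m \<le> ?\<mu> K0 * ?\<mu> L0" by simp
  have "?\<mu> K' * ?\<mu> L' \<le> ?\<mu> K0 * ?\<mu> L0" if "(K', L') \<in> sine_class R" for K' L'
  proof -
    have "?\<mu> K' * ?\<mu> L' \<in> P"
      using that by (force simp: P_def)
    then have "?\<mu> K' * ?\<mu> L' \<le> m"
      unfolding m_def by (intro cSup_upper \<open>bdd_above P\<close>)
    with m_le0 show ?thesis by simp
  qed
  moreover have "K0 = sine_polar L0"
    by (simp add: K0_def L0_def sine_polar_triple)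
  ultimately have "sine_maximal R K0 L0"
    unfolding sine_maximal_def using KL0 L0_def by blast
  then show ?thesis
    by (rule that)
qed

section \<open>Contact points of maximisers\<close>

lemma orthogonal_split_unique:
  fixes u :: "'a::euclidean_space"
  assumes "norm u = 1" "y \<bullet> u = 0" "z \<bullet> u = 0" "y + s *\<^sub>R u = z + t *\<^sub>R u"
  shows "y = z \<and> s = t"
proof -
  have uu: "u \<bullet> u = 1"
    using assms(1) by (simp add: power2_norm_eq_inner[symmetric])
  have "s = t"
    using arg_cong[OF assms(4), of "\<lambda>x. x \<bullet> u"] by (simp add: inner_add_left uu assms(2,3))
  then show ?thesis
    using assms(4) by simp
qed

text \<open>The polar of the symmetral of \<open>L\<close> contains the symmetral of
  \<open>K\<close>. Maximality, tested on this polar paired with the symmetral of \<open>L\<close>,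
  bounds its volume by that of \<open>K\<close>, which symmetrisation does not decrease. Equal
  volumes force equality of the sets.\<close>

lemma sine_maximal_steiner:
  fixes K L :: "'a::euclidean_space set"
  assumes dim: "DIM('a) \<ge> 2" and R: "0 < R" and max: "sine_maximal R K L" and u: "norm u = 1"
  shows "steiner u K = sine_polar (steiner u L)"
proof (rule compact_eq_convex_of_measure_le)
  note KL = sine_maximalD[OF max]
  have conv: "convex K" "convex L"
    using KL(2,3) convex_sine_polar by metis+
  have cpt: "compact K" "compact L"
    using KL(1) by (auto simp: sine_class_def)
  show "compact (steiner u K)"
    using compact_steiner[OF u cpt(1)] .
  have "(sine_polar (steiner u L), steiner u L) \<in> sine_class R"
    using KL(1) compact_steiner[OF u] cball_subset_steiner[OF u] steiner_subset_cball[OF u] R dim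
    by (intro sine_polar_mem_sine_class) (auto simp: sine_class_def)
  note cls = this
  then show "compact (sine_polar (steiner u L))"
    by (simp add: sine_class_def)
  have "ball 0 (1 / R) \<subseteq> sine_polar (steiner u L)"
    using cls ball_subset_cball by (fastforce simp: sine_class_def)
  then have "ball 0 (1 / R) \<subseteq> interior (sine_polar (steiner u L))"
    by (simp add: interior_maximal)
  then show "interior (sine_polar (steiner u L)) \<noteq> {}"
    using R by auto
  show "convex (sine_polar (steiner u L))"
    by (rule convex_sine_polar)
  show "steiner u K \<subseteq> sine_polar (steiner u L)"
    using KL(2) by (intro steiner_subset_sine_polar[OF u]) auto
  have "measure lebesgue (sine_polar (steiner u L)) * measure lebesgue L
      \<le> measure lebesgue (sine_polar (steiner u L)) * measure lebesgue (steiner u L)"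
    using measure_le_steiner[OF u cpt(2) conv(2)] by (intro mult_left_mono) auto
  also have "\<dots> \<le> measure lebesgue K * measure lebesgue L"
    using KL(4)[OF cls] .
  finally have "measure lebesgue (sine_polar (steiner u L)) \<le> measure lebesgue K"
    using sine_class_measure_pos[OF KL(1) R] by simp
  also have "\<dots> \<le> measure lebesgue (steiner u K)"
    using measure_le_steiner[OF u cpt(1) conv(1)] .
  finally show "measure lebesgue (sine_polar (steiner u L)) \<le> measure lebesgue (steiner u K)" .
qed

text \<open>Here \<open>m\<close> and \<open>h\<close> are the midpoint parameter and the half
  length of the full chord of \<open>K\<close> on its line. The end of the symmetrised chord has
  bracket one with a point of the symmetral of \<open>L\<close>; equality in the parallelogram
  estimate then yields contact at both ends and proportional midpoints.\<close>

lemma sine_maximal_contact: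
  fixes K L :: "'a::euclidean_space set"
  assumes dim: "DIM('a) \<ge> 2" and R: "0 < R" and max: "sine_maximal R K L" and u: "norm u = 1"
    and y: "y \<bullet> u = 0" "y + (m + h) *\<^sub>R u \<in> K" "y + (m - h) *\<^sub>R u \<in> K" and h: "0 \<le> h"
    and long: "\<And>a b. y + a *\<^sub>R u \<in> K \<Longrightarrow> y + b *\<^sub>R u \<in> K \<Longrightarrow> a - b \<le> 2 * h"
  obtains x M t where "x \<bullet> u = 0" "x + (M + t) *\<^sub>R u \<in> L" "x + (M - t) *\<^sub>R u \<in> L"
    "sine_bracket (x + (M + t) *\<^sub>R u) (y + (m + h) *\<^sub>R u) = 1"
    "sine_bracket (x + (M - t) *\<^sub>R u) (y + (m - h) *\<^sub>R u) = 1"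
    "M *\<^sub>R y = m *\<^sub>R x"
proof -
  note KL = sine_maximalD(1,2)[OF max]
  then have KL1: "sine_bracket x' y' \<le> 1" if "x' \<in> L" "y' \<in> K" for x' y'
    using that by (metis in_sine_polar_iff sine_bracket_commute)
  let ?K = "steiner u K" and ?L = "steiner u L"
  have K_eq: "?K = sine_polar ?L"
    by (rule sine_maximal_steiner[OF dim R max u])
  have L: "compact ?L" "?L \<subseteq> cball 0 R" "?L \<noteq> {}"
    using KL(1) compact_steiner[OF u, of L] steiner_subset_cball[OF u, of L R]
      cball_subset_steiner[OF u, of "1 / R" L] R by (auto simp: sine_class_def)
  define w where "w = y + h *\<^sub>R u"
  have "w \<in> ?K"
    using steinerI[OF u y(1,2,3)] by (simp add: w_def)
  have "continuous_on ?L (\<lambda>v. sine_bracket v w)"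
    by (intro continuous_intros)
  from continuous_attains_sup[OF L(1,3) this]
  obtain v where v: "v \<in> ?L" "\<And>v'. v' \<in> ?L \<Longrightarrow> sine_bracket v' w \<le> sine_bracket v w"
    by blast
  have vw1: "sine_bracket v w \<le> 1"
    using \<open>w \<in> ?K\<close> v unfolding K_eq by (auto simp: in_sine_polar_iff sine_bracket_commute)
  \<comment> \<open>Otherwise \<open>w\<close> could be moved by \<open>e\<close> along
    \<open>u\<close> inside the polar of \<open>steiner u L\<close>, which is the symmetral of
    \<open>K\<close>, and \<open>K\<close> would have a longer chord on the same line.\<close>
  have "\<not> sine_bracket v w < 1"
  proof
    assume lt: "sine_bracket v w < 1"
    define e where "e = (1 - sine_bracket v w) / R"
    have "0 < e"
      using lt R by (simp add: e_def)
    have "y + (h + e) *\<^sub>R u \<in> ?K"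
      unfolding K_eq in_sine_polar_iff
    proof
      fix v' assume v': "v' \<in> ?L"
      have "sine_bracket v' (w + e *\<^sub>R u) \<le> sine_bracket v' w + sine_bracket v' (e *\<^sub>R u)"
        by (rule sine_bracket_triangle)
      also have "sine_bracket v' (e *\<^sub>R u) \<le> e * R"
        using sine_bracket_le[of v' u] u v' L(2) \<open>0 < e\<close> by (auto intro: order_trans)
      also have "sine_bracket v' w \<le> sine_bracket v w"
        using v v' by blast
      finally have "sine_bracket v' (w + e *\<^sub>R u) \<le> 1"
        using R by (simp add: e_def)
      then show "sine_bracket (y + (h + e) *\<^sub>R u) v' \<le> 1"
        by (simp add: w_def sine_bracket_commute algebra_simps)
    qed
    then obtain z a b where z: "z \<bullet> u = 0" "z + a *\<^sub>R u \<in> K" "z + b *\<^sub>R u \<in> K"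
      and eq: "y + (h + e) *\<^sub>R u = z + ((a - b) / 2) *\<^sub>R u"
      using steinerE[OF _ u] by metis
    have "y = z" "h + e = (a - b) / 2"
      using orthogonal_split_unique[OF u y(1) z(1) eq] by auto
    then show False
      using long[of a b] z \<open>0 < e\<close> by simp
  qed
  with vw1 have vw: "sine_bracket v w = 1"
    by simp
  obtain x c d where x: "x \<bullet> u = 0" "x + c *\<^sub>R u \<in> L" "x + d *\<^sub>R u \<in> L"
    and v_eq: "v = x + ((c - d) / 2) *\<^sub>R u"
    using steinerE[OF v(1) u] by metis
  define M t where "M = (c + d) / 2" and "t = (c - d) / 2"
  have Mt: "M + t = c" "M - t = d"
    by (simp_all add: M_def t_def field_simps)
  \<comment> \<open>\<open>V\<close> belongs to the symmetrised pair, and \<open>W\<close> measures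
    how far the midpoints are from being proportional. Neither \<open>W + V\<close> nor
    \<open>W - V\<close> is longer than \<open>V\<close>, so the parallelogram law forces
    \<open>W = 0\<close>.\<close>
  define V W where "V = t *\<^sub>R y - h *\<^sub>R x" and "W = M *\<^sub>R y - m *\<^sub>R x"
  note split = sine_bracket_split_square[OF u x(1) y(1)]
  have VW: "(M + t) *\<^sub>R y - (m + h) *\<^sub>R x = W + V" "(M - t) *\<^sub>R y - (m - h) *\<^sub>R x = W - V"
    by (simp_all add: V_def W_def algebra_simps)
  have V: "(sine_bracket x y)\<^sup>2 + (norm V)\<^sup>2 = 1"
    using split[of t h] vw by (simp add: v_eq w_def t_def V_def)
  have "(sine_bracket (x + (M + t) *\<^sub>R u) (y + (m + h) *\<^sub>R u))\<^sup>2 \<le> 1"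
    "(sine_bracket (x + (M - t) *\<^sub>R u) (y + (m - h) *\<^sub>R u))\<^sup>2 \<le> 1"
    using KL1 x y by (auto simp: Mt power_le_one)
  then have "(sine_bracket x y)\<^sup>2 + (norm (W + V))\<^sup>2 \<le> 1" "(sine_bracket x y)\<^sup>2 + (norm (W - V))\<^sup>2 \<le> 1"
    unfolding split VW .
  moreover have "(norm (W + V))\<^sup>2 + (norm (W - V))\<^sup>2 = 2 * (norm W)\<^sup>2 + 2 * (norm V)\<^sup>2"
    unfolding power2_norm_eq_inner by (simp add: inner_add inner_diff inner_commute)
  ultimately have "2 * (norm W)\<^sup>2 \<le> 0"
    using V by linarith
  then have "W = 0"
    by simp
  have "(sine_bracket (x + (M + t) *\<^sub>R u) (y + (m + h) *\<^sub>R u))\<^sup>2 = 1"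
    "(sine_bracket (x + (M - t) *\<^sub>R u) (y + (m - h) *\<^sub>R u))\<^sup>2 = 1"
    unfolding split VW using V \<open>W = 0\<close> by auto
  then have "sine_bracket (x + (M + t) *\<^sub>R u) (y + (m + h) *\<^sub>R u) = 1"
    "sine_bracket (x + (M - t) *\<^sub>R u) (y + (m - h) *\<^sub>R u) = 1"
    by (metis abs_of_nonneg power2_eq_1_iff sine_bracket_nonneg abs_minus_cancel abs_one)+
  then show ?thesis
    using that[of x M t] x Mt \<open>W = 0\<close> by (simp add: W_def)
qed

section \<open>Maximisers in dimension at least three\<close>

lemma touching_point:
  fixes K :: "'a::euclidean_space set"
  assumes K: "compact K" "convex K" and q: "q \<in> interior K"
  obtains p \<delta> where "0 < \<delta>" "dist q p = \<delta>" "cball q \<delta> \<subseteq> K" "ball q \<delta> \<subseteq> interior K"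
    "p \<in> K" "p \<notin> interior K"
proof -
  have "interior K \<noteq> UNIV"
    using K(1) interior_subset[of K] compact_imp_bounded not_bounded_UNIV by (metis top.extremum_uniqueI)
  then have "closed (- interior K)" "- interior K \<noteq> {}"
    by auto
  then obtain p where p: "p \<in> - interior K" "\<And>y. y \<in> - interior K \<Longrightarrow> dist q p \<le> dist q y"
    using distance_attains_inf by blast
  define \<delta> where "\<delta> = dist q p"
  have "q \<noteq> p"
    using p(1) q by auto
  then have "0 < \<delta>"
    by (simp add: \<delta>_def)
  have ball: "ball q \<delta> \<subseteq> interior K"
    using p(2) by (force simp: \<delta>_def)
  then have "closure (ball q \<delta>) \<subseteq> K"
    using interior_subset[of K] K(1) by (intro closure_minimal) (auto simp: compact_imp_closed)
  then have "cball q \<delta> \<subseteq> K"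
    using \<open>0 < \<delta>\<close> by simp
  moreover have "p \<in> cball q \<delta>"
    by (simp add: \<delta>_def)
  ultimately show ?thesis
    using that[OF \<open>0 < \<delta>\<close> \<delta>_def[symmetric] _ ball] p(1) by blast
qed

lemma supporting_normal:
  fixes K :: "'a::euclidean_space set"
  assumes "convex K" "interior K \<noteq> {}" "p \<notin> interior K"
  obtains n where "n \<noteq> 0" "\<And>w. w \<in> K \<Longrightarrow> n \<bullet> w \<le> n \<bullet> p"
proof -
  obtain n b where n: "n \<noteq> 0" "\<forall>x\<in>interior K. n \<bullet> x \<le> b" "\<forall>x\<in>{p}. n \<bullet> x \<ge> b"
    using separating_hyperplane_sets[of "interior K" "{p}"] assms by auto
  have "K \<subseteq> closure (interior K)"
    using assms closure_subset convex_closure_interior by blast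
  also have "\<dots> \<subseteq> {x. n \<bullet> x \<le> b}"
    using n(2) by (intro closure_minimal closed_halfspace_le) auto
  finally have "n \<bullet> w \<le> n \<bullet> p" if "w \<in> K" for w
    using that n(3) by auto
  with n(1) show ?thesis
    using that by blast
qed

text \<open>The point of the ball farthest in direction \<open>n\<close> belongs to
  \<open>K\<close>, which forces equality in the Cauchy-Schwarz inequality for \<open>n\<close> and
  \<open>p - q\<close>.\<close>

lemma normal_at_touching_point:
  fixes K :: "'a::euclidean_space set"
  assumes "cball q \<delta> \<subseteq> K" "0 < \<delta>" "dist q p = \<delta>" and n: "\<And>w. w \<in> K \<Longrightarrow> n \<bullet> w \<le> n \<bullet> p"
  shows "n = (norm n / \<delta>) *\<^sub>R (p - q)"
proof (cases "n = 0")
  case False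
  define w where "w = q + (\<delta> / norm n) *\<^sub>R n"
  have "w \<in> K"
    using assms(1,2) False by (intro subsetD[OF assms(1)]) (auto simp: w_def dist_norm)
  then have "n \<bullet> q + \<delta> * norm n \<le> n \<bullet> p"
    using n[of w] False by (simp add: w_def inner_add_right power2_norm_eq_inner[symmetric] power2_eq_square)
  moreover have "norm (p - q) = \<delta>"
    using assms(3) by (simp add: dist_norm norm_minus_commute)
  ultimately have "norm n * norm (p - q) \<le> n \<bullet> (p - q)"
    by (simp add: inner_diff_right mult.commute)
  then have "n \<bullet> (p - q) = norm n * norm (p - q)"
    using norm_cauchy_schwarz[of n "p - q"] by simp
  then have "norm n *\<^sub>R (p - q) = norm (p - q) *\<^sub>R n"
    by (simp add: norm_cauchy_schwarz_eq)
  then have "(1 / \<delta>) *\<^sub>R (norm n *\<^sub>R (p - q)) = (1 / \<delta>) *\<^sub>R \<delta> *\<^sub>R n"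
    using \<open>norm (p - q) = \<delta>\<close> by simp
  then show ?thesis
    using assms(2) by simp
qed simp

text \<open>The vector is half the gradient at \<open>p\<close> of the squared seminorm
  \<open>sine_bracket a\<close>. This seminorm is at most one on \<open>K\<close> and equals one at
  \<open>p\<close>, so the gradient is an outer normal there.\<close>

lemma contact_normal:
  assumes "K \<subseteq> sine_polar L" "a \<in> L" "sine_bracket a p = 1" "w \<in> K"
  shows "((norm a)\<^sup>2 *\<^sub>R p - (a \<bullet> p) *\<^sub>R a) \<bullet> w \<le> ((norm a)\<^sup>2 *\<^sub>R p - (a \<bullet> p) *\<^sub>R a) \<bullet> p"
proof -
  have *: "((norm a)\<^sup>2 *\<^sub>R p - (a \<bullet> p) *\<^sub>R a) \<bullet> w = wedge_vec a p \<bullet> wedge_vec a w" for w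
    by (simp add: inner_wedge_vec inner_diff_left)
  have "sine_bracket a w \<le> 1"
    using assms(1,2,4) by (auto simp: subset_sine_polar_iff)
  then have "wedge_vec a p \<bullet> wedge_vec a w \<le> 1"
    using norm_cauchy_schwarz[of "wedge_vec a p" "wedge_vec a w"] assms(3)
    by (simp add: sine_bracket_wedge_vec)
  also have "1 = wedge_vec a p \<bullet> wedge_vec a p"
    using assms(3) by (simp add: sine_bracket_wedge_vec power2_norm_eq_inner[symmetric])
  finally show ?thesis
    unfolding * .
qed

lemma contact_at_touching_point:
  assumes "K \<subseteq> sine_polar L" "a \<in> L" "sine_bracket a p = 1"
    and "cball q \<delta> \<subseteq> K" "0 < \<delta>" "dist q p = \<delta>"
  obtains c where "(norm a)\<^sup>2 *\<^sub>R p - (a \<bullet> p) *\<^sub>R a = c *\<^sub>R (p - q)"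
  using that normal_at_touching_point[OF assms(4-6) contact_normal[OF assms(1-3)]] by blast

lemma convex_shrink_interior:
  fixes K :: "'a::euclidean_space set"
  assumes "convex K" "0 \<in> interior K" "w \<in> K" "0 \<le> c" "c < 1"
  shows "c *\<^sub>R w \<in> interior K"
  using mem_interior_convex_shrink[OF assms(1-3), of "1 - c"] assms(4,5) by (simp add: algebra_simps)

lemma sine_maximal_body:
  fixes K L :: "'a::euclidean_space set"
  assumes R: "0 < R" and max: "sine_maximal R K L"
  shows "compact K" "convex K" "0 \<in> interior K" "\<And>w. w \<in> K \<Longrightarrow> - w \<in> K"
    "K \<subseteq> sine_polar L"
proof -
  note KL = sine_maximalD[OF max]
  show "compact K" "K \<subseteq> sine_polar L"
    using KL(1) by (auto simp: sine_class_def)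
  show "convex K"
    using KL(2) convex_sine_polar by metis
  show "- w \<in> K" if "w \<in> K" for w
    using KL(2) that minus_mem_sine_polar by blast
  have "ball 0 (1 / R) \<subseteq> K"
    using KL(1) ball_subset_cball by (fastforce simp: sine_class_def)
  then show "0 \<in> interior K"
    using R by (intro subsetD[OF interior_maximal[of "ball 0 (1 / R)"]]) auto
qed

lemma chord_end:
  fixes K :: "'a::euclidean_space set"
  assumes "compact K" "p \<in> K" "norm u = 1"
  obtains s where "0 \<le> s" "p + s *\<^sub>R u \<in> K" "\<And>t. p + t *\<^sub>R u \<in> K \<Longrightarrow> t \<le> s"
proof -
  let ?S = "{s. p + s *\<^sub>R u \<in> K}"
  have "closed ((\<lambda>s. p + s *\<^sub>R u) -` K)"
    by (intro closed_vimage compact_imp_closed assms continuous_intros)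
  moreover obtain B where B: "\<And>y. y \<in> K \<Longrightarrow> norm y \<le> B"
    using compact_imp_bounded[OF assms(1)] bounded_iff by blast
  have "norm s \<le> B + norm p" if "s \<in> ?S" for s
    using B[of "p + s *\<^sub>R u"] that norm_triangle_ineq4[of "p + s *\<^sub>R u" p] assms(3) by simp
  then have "bounded ?S"
    unfolding bounded_iff by blast
  ultimately have "compact ?S"
    by (simp add: compact_eq_bounded_closed vimage_def)
  moreover have "0 \<in> ?S"
    using assms(2) by simp
  ultimately obtain s where "s \<in> ?S" "\<And>t. t \<in> ?S \<Longrightarrow> t \<le> s"
    using compact_attains_sup[of ?S] by blast
  then show ?thesis
    using that[of s] \<open>0 \<in> ?S\<close> by auto
qed

section \<open>Dimension at least three: collinearity of nearest boundary points\<close>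

text \<open>The direction \<open>u\<close> satisfies \<open>u \<bullet> p > 0\<close> and \<open>u \<bullet> \<nu> < 0\<close>, which makes the midpoint of the chord nonzero, so that
  the contact partner of \<open>p\<close> lies in \<open>span {p, u}\<close>; its normal at \<open>p\<close> does too, but \<open>\<nu>\<close> does not.\<close>
lemma sine_maximal_touching_collinear:
  fixes K L :: "'a::euclidean_space set"
  assumes dim: "DIM('a) \<ge> 3" and R: "0 < R" and max: "sine_maximal R K L"
    and q: "q \<noteq> 0" and touch: "0 < \<delta>" "dist q p = \<delta>" "cball q \<delta> \<subseteq> K" "p \<in> K" "p \<notin> interior K"
  shows "\<exists>c. p = c *\<^sub>R q"
proof (rule ccontr)
  assume contra: "\<nexists>c. p = c *\<^sub>R q"
  note K = sine_maximal_body[OF R max]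
  define \<nu> where "\<nu> = p - q"
  have "p \<noteq> 0" "\<nu> \<noteq> 0"
    using contra by (metis scaleR_zero_left, metis \<nu>_def right_minus_eq scaleR_one)
  have indep: "\<nu> \<noteq> k *\<^sub>R p" for k
  proof
    assume "\<nu> = k *\<^sub>R p"
    then have eq: "q = (1 - k) *\<^sub>R p"
      by (simp add: \<nu>_def algebra_simps)
    with q have "1 - k \<noteq> 0"
      by auto
    then have "p = (1 / (1 - k)) *\<^sub>R q"
      by (simp add: eq)
    with contra show False by blast
  qed
  have lt: "p \<bullet> \<nu> < norm p * norm \<nu>"
  proof (rule ccontr)
    assume "\<not> p \<bullet> \<nu> < norm p * norm \<nu>"
    then have "p \<bullet> \<nu> = norm p * norm \<nu>"
      using norm_cauchy_schwarz[of p \<nu>] by simp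
    then have "norm p *\<^sub>R \<nu> = norm \<nu> *\<^sub>R p"
      by (simp add: norm_cauchy_schwarz_eq)
    then have "(1 / norm p) *\<^sub>R norm p *\<^sub>R \<nu> = (1 / norm p) *\<^sub>R norm \<nu> *\<^sub>R p"
      by simp
    then show False
      using indep[of "norm \<nu> / norm p"] \<open>p \<noteq> 0\<close> by simp
  qed
  have "dim {p, \<nu>} \<le> card {p, \<nu>}"
    by (rule dim_le_card') auto
  also have "\<dots> < DIM('a)"
    using dim card_insert_le_m1[of 2 "{\<nu>}" p] by simp
  finally have "dim {p, \<nu>} < DIM('a)" .
  from orthogonal_to_subspace_exists[OF this]
  obtain e where "e \<noteq> 0" "\<And>y. y \<in> span {p, \<nu>} \<Longrightarrow> orthogonal e y"
    by blast
  then have e: "e \<noteq> 0" "e \<bullet> p = 0" "e \<bullet> \<nu> = 0"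
    by (simp_all add: orthogonal_def span_base)
  \<comment> \<open>The difference of the unit vectors along \<open>p\<close> and
    \<open>\<nu>\<close> produces the two signs, by the strict Cauchy-Schwarz inequality. Adding
    \<open>e\<close>, which exists from dimension three on, takes the direction out of the plane of
    \<open>p\<close> and \<open>\<nu>\<close>.\<close>
  define v where "v = (1 / norm p) *\<^sub>R p - (1 / norm \<nu>) *\<^sub>R \<nu> + e"
  have sq: "p \<bullet> p = norm p * norm p" "\<nu> \<bullet> \<nu> = norm \<nu> * norm \<nu>"
    by (simp_all add: power2_norm_eq_inner[symmetric] power2_eq_square)
  have pos: "0 < norm p" "0 < norm \<nu>"
    using \<open>p \<noteq> 0\<close> \<open>\<nu> \<noteq> 0\<close> by simp_all
  have "v \<bullet> p = norm p - (p \<bullet> \<nu>) / norm \<nu>" "v \<bullet> \<nu> = (p \<bullet> \<nu>) / norm p - norm \<nu>" "v \<bullet> e = e \<bullet> e"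
    using e pos by (simp_all add: v_def inner_add_right inner_diff_right sq inner_commute)
  moreover have "(p \<bullet> \<nu>) / norm \<nu> < norm p" "(p \<bullet> \<nu>) / norm p < norm \<nu>"
    using lt pos by (simp_all add: divide_less_eq mult.commute)
  ultimately have v: "0 < v \<bullet> p" "v \<bullet> \<nu> < 0" "v \<bullet> e \<noteq> 0"
    using e(1) by simp_all
  then have "v \<noteq> 0" by auto
  define u where "u = (1 / norm v) *\<^sub>R v"
  have u: "norm u = 1" "0 < u \<bullet> p" "u \<bullet> \<nu> < 0" "u \<bullet> e \<noteq> 0"
    using v \<open>v \<noteq> 0\<close> by (auto simp: u_def divide_neg_pos)
  obtain n where n: "n \<noteq> 0" "\<And>w. w \<in> K \<Longrightarrow> n \<bullet> w \<le> n \<bullet> p"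
    using supporting_normal[of K p] K touch by blast
  have n_eq: "n = (norm n / \<delta>) *\<^sub>R \<nu>"
    unfolding \<nu>_def by (rule normal_at_touching_point[OF touch(3,1,2) n(2)])
  have nu: "n \<bullet> u < 0"
  proof -
    have "n \<bullet> u = (norm n / \<delta>) * (u \<bullet> \<nu>)"
      by (subst n_eq) (simp add: inner_commute)
    then show ?thesis
      using n(1) touch(1) u(3) by (simp add: mult_pos_neg divide_neg_pos)
  qed
  obtain s where s: "0 \<le> s" "p + s *\<^sub>R u \<in> K" "\<And>t. p + t *\<^sub>R u \<in> K \<Longrightarrow> t \<le> s"
    using chord_end[OF K(1) touch(4) u(1)] by blast
  \<comment> \<open>Since \<open>n \<bullet> u < 0\<close> for an outer normal \<open>n\<close> at
    \<open>p\<close>, the chord starts at \<open>p\<close>.\<close>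
  have nonneg: "0 \<le> t" if "p + t *\<^sub>R u \<in> K" for t
    using n(2)[OF that] nu by (simp add: inner_add_right mult_le_0_iff)
  define k where "k = p \<bullet> u"
  define y where "y = p - k *\<^sub>R u"
  have "u \<bullet> u = 1"
    using u(1) by (simp add: power2_norm_eq_inner[symmetric])
  then have yu: "y \<bullet> u = 0"
    by (simp add: y_def k_def inner_diff_left)
  have y: "y + a *\<^sub>R u = p + (a - k) *\<^sub>R u" for a
    by (simp add: y_def algebra_simps)
  define m h where "m = k + s / 2" and "h = s / 2"
  have mh: "m + h = k + s" "m - h = k"
    by (simp_all add: m_def h_def)
  have "0 < m"
    using u(2) s(1) by (simp add: m_def k_def inner_commute)
  obtain x M t where x: "x + (M - t) *\<^sub>R u \<in> L"
    "sine_bracket (x + (M - t) *\<^sub>R u) (y + (m - h) *\<^sub>R u) = 1" "M *\<^sub>R y = m *\<^sub>R x"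
  proof (rule sine_maximal_contact[OF _ R max u(1) yu, of m h])
    show "y + (m + h) *\<^sub>R u \<in> K" "y + (m - h) *\<^sub>R u \<in> K"
      unfolding mh y using s(2) touch(4) by simp_all
    show "a - b \<le> 2 * h" if "y + a *\<^sub>R u \<in> K" "y + b *\<^sub>R u \<in> K" for a b
      using that s(3)[of "a - k"] nonneg[of "b - k"] by (simp add: y h_def)
  qed (use dim s(1) h_def in auto)
  define b where "b = x + (M - t) *\<^sub>R u"
  have b1: "sine_bracket b p = 1"
    using x(2) by (simp add: b_def y mh)
  \<comment> \<open>As \<open>m\<close> is nonzero, the proportionality of midpoints puts
    \<open>b\<close> into the span of \<open>p\<close> and \<open>u\<close>.\<close>
  have "x = (M / m) *\<^sub>R y"
    using arg_cong[OF x(3), of "\<lambda>z. (1 / m) *\<^sub>R z"] \<open>0 < m\<close> by simp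
  then have b_eq: "b = (M / m) *\<^sub>R p + (M - t - M / m * k) *\<^sub>R u"
    by (simp add: b_def y_def algebra_simps)
  obtain c where c: "(norm b)\<^sup>2 *\<^sub>R p - (b \<bullet> p) *\<^sub>R b = c *\<^sub>R \<nu>"
    unfolding \<nu>_def
    using contact_at_touching_point[OF K(5) x(1)[folded b_def] b1 touch(3,1,2)] by blast
  \<comment> \<open>The contact normal is a multiple of \<open>\<nu>\<close> and hence orthogonal to
    \<open>e\<close>. If \<open>b \<bullet> p = 0\<close>, then \<open>\<nu>\<close> is parallel to
    \<open>p\<close>; if \<open>b \<bullet> e = 0\<close>, then \<open>b\<close> is parallel to
    \<open>p\<close> and their bracket vanishes.\<close>
  have "(b \<bullet> p) * (b \<bullet> e) = 0"
    using arg_cong[OF c, of "\<lambda>z. z \<bullet> e"] e by (simp add: inner_diff_right inner_commute)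
  then consider "b \<bullet> p = 0" | "b \<bullet> e = 0" by auto
  then show False
  proof cases
    case 1
    have "b \<noteq> 0"
      using b1 by auto
    with c 1 have "c *\<^sub>R \<nu> \<noteq> 0" "c *\<^sub>R \<nu> = (norm b)\<^sup>2 *\<^sub>R p"
      using \<open>p \<noteq> 0\<close> by auto
    then have "(1 / c) *\<^sub>R c *\<^sub>R \<nu> = (1 / c) *\<^sub>R (norm b)\<^sup>2 *\<^sub>R p" "c \<noteq> 0"
      by (simp_all only:) auto
    then have "\<nu> = ((norm b)\<^sup>2 / c) *\<^sub>R p"
      by simp
    then show False
      using indep by blast
  next
    case 2
    then have "M - t - M / m * k = 0"
      using e u(4) by (simp add: b_eq inner_add_right inner_commute)
    then have "b = (M / m) *\<^sub>R p"
      by (simp only: b_eq) simp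
    then show False
      using b1 by simp
  qed
qed

text \<open>Let \<open>w\<close> in \<open>K\<close> lie outside the largest inscribed centred ball.
  From a point \<open>q\<close> near \<open>0\<close> on the ray of \<open>w\<close>, a nearest
  boundary point lies on the line of \<open>w\<close> and so is about \<open>norm w\<close> away,
  although \<open>p0\<close> is only about \<open>r\<close> away.\<close>

lemma sine_maximal_imp_cball:
  fixes K L :: "'a::euclidean_space set"
  assumes dim: "DIM('a) \<ge> 3" and R: "0 < R" and max: "sine_maximal R K L"
  obtains r where "0 < r" "K = cball 0 r"
proof -
  note K = sine_maximal_body[OF R max]
  obtain p0 r where r: "0 < r" "dist 0 p0 = r" "cball 0 r \<subseteq> K" "p0 \<notin> interior K"
    using touching_point[OF K(1-3)] by metis
  have "norm w \<le> r" if w: "w \<in> K" for w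
  proof (rule ccontr)
    assume "\<not> norm w \<le> r"
    then have lt: "r < norm w" by simp
    \<comment> \<open>The distance estimate below costs \<open>2 * \<epsilon> * norm w\<close>,
      which this choice makes half of \<open>norm w - r\<close>.\<close>
    define \<epsilon> where "\<epsilon> = (norm w - r) / (4 * norm w)"
    have w0: "0 < norm w"
      using lt r(1) by linarith
    have \<epsilon>: "0 < \<epsilon>" "\<epsilon> < 1"
      using lt w0 r(1) by (auto simp: \<epsilon>_def field_simps)
    define q where "q = \<epsilon> *\<^sub>R w"
    have "q \<in> interior K" "q \<noteq> 0"
      using convex_shrink_interior[OF K(2,3) w, of \<epsilon>] \<epsilon> w0 by (auto simp: q_def)
    then obtain p \<delta> where p: "0 < \<delta>" "dist q p = \<delta>" "cball q \<delta> \<subseteq> K" "ball q \<delta> \<subseteq> interior K"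
      "p \<in> K" "p \<notin> interior K"
      using touching_point[OF K(1,2)] by metis
    obtain c where "p = c *\<^sub>R q"
      using sine_maximal_touching_collinear[OF dim R max \<open>q \<noteq> 0\<close> p(1-3,5,6)] by blast
    then have p_eq: "p = (c * \<epsilon>) *\<^sub>R w"
      by (simp add: q_def)
    \<comment> \<open>By central symmetry and convexity, every multiple of \<open>w\<close> with
      factor of absolute value below one is interior, whereas \<open>p\<close> is not.\<close>
    have "1 \<le> \<bar>c * \<epsilon>\<bar>"
    proof (rule ccontr)
      assume "\<not> 1 \<le> \<bar>c * \<epsilon>\<bar>"
      then have "\<bar>c * \<epsilon>\<bar> *\<^sub>R w \<in> interior K" "\<bar>c * \<epsilon>\<bar> *\<^sub>R (- w) \<in> interior K"
        using convex_shrink_interior[OF K(2,3) w, of "\<bar>c * \<epsilon>\<bar>"]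
          convex_shrink_interior[OF K(2,3) K(4)[OF w], of "\<bar>c * \<epsilon>\<bar>"] by simp_all
      then have "p \<in> interior K"
        unfolding p_eq by (cases "0 \<le> c * \<epsilon>") (auto simp: abs_if split: if_splits)
      with p(6) show False by blast
    qed
    then have "1 - \<epsilon> \<le> \<bar>\<epsilon> - c * \<epsilon>\<bar>"
      using \<epsilon> by linarith
    then have "(1 - \<epsilon>) * norm w \<le> \<bar>\<epsilon> - c * \<epsilon>\<bar> * norm w"
      by (intro mult_right_mono) auto
    also have "\<dots> = norm ((\<epsilon> - c * \<epsilon>) *\<^sub>R w)"
      by simp
    also have "(\<epsilon> - c * \<epsilon>) *\<^sub>R w = q - p"
      by (simp add: q_def p_eq algebra_simps)
    also have "norm (q - p) = \<delta>"
      using p(2) by (simp add: dist_norm)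
    also have "\<delta> \<le> dist q p0"
      using p(4) r(4) by (meson in_mono mem_ball not_le)
    also have "\<dots> \<le> norm q + norm p0"
      by (simp add: dist_norm norm_triangle_ineq4)
    also have "\<dots> = \<epsilon> * norm w + r"
      using \<epsilon> r(2) by (simp add: q_def)
    finally have "norm w - r \<le> 2 * \<epsilon> * norm w"
      by (simp add: algebra_simps)
    also have "\<dots> = (norm w - r) / 2"
      using w0 by (simp add: \<epsilon>_def)
    finally show False
      using lt by simp
  qed
  then have "K = cball 0 r"
    using r(3) by auto
  with r(1) show ?thesis
    by (rule that)
qed

section \<open>Maximisers in the plane\<close>

text \<open>Difference quotients are bounded by a multiple of the distance, so the derivative within
  \<open>S\<close> vanishes.\<close>

lemma quadratic_modulus_imp_constant:
  fixes f :: "real \<Rightarrow> real"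
  assumes "convex S" and f: "\<And>x y. x \<in> S \<Longrightarrow> y \<in> S \<Longrightarrow> \<bar>f y - f x\<bar> \<le> C * (y - x)\<^sup>2"
    and "x \<in> S" "y \<in> S"
  shows "f x = f y"
proof -
  have "(f has_field_derivative 0) (at z within S)" if z: "z \<in> S" for z
    unfolding has_field_derivative_iff
  proof (rule Lim_null_comparison)
    have "norm ((f y - f z) / (y - z)) \<le> C * \<bar>y - z\<bar>" if "y \<in> S" "y \<noteq> z" for y
      using f[OF z \<open>y \<in> S\<close>] \<open>y \<noteq> z\<close>
      by (simp add: abs_divide divide_le_eq power2_eq_square mult.assoc abs_mult_self_eq)
    then show "\<forall>\<^sub>F y in at z within S. norm ((f y - f z) / (y - z)) \<le> C * \<bar>y - z\<bar>"
      by (auto simp: eventually_at_filter)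
    have "((\<lambda>y. C * \<bar>y - z\<bar>) \<longlongrightarrow> C * \<bar>z - z\<bar>) (at z within S)"
      by (intro tendsto_intros)
    then show "((\<lambda>y. C * \<bar>y - z\<bar>) \<longlongrightarrow> 0) (at z within S)"
      by simp
  qed
  then obtain c where "\<And>x. x \<in> S \<Longrightarrow> f x = c"
    using has_field_derivative_zero_constant[OF assms(1)] by blast
  then show ?thesis
    using assms(3,4) by simp
qed

lemma orthonormal_plane_expansion:
  fixes e1 e2 :: "'a::euclidean_space"
  assumes dim: "DIM('a) = 2" and e: "norm e1 = 1" "norm e2 = 1" "e1 \<bullet> e2 = 0"
  shows "w = (w \<bullet> e1) *\<^sub>R e1 + (w \<bullet> e2) *\<^sub>R e2"
proof (rule ccontr)
  define r where "r = w - ((w \<bullet> e1) *\<^sub>R e1 + (w \<bullet> e2) *\<^sub>R e2)"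
  assume "w \<noteq> (w \<bullet> e1) *\<^sub>R e1 + (w \<bullet> e2) *\<^sub>R e2"
  then have "r \<noteq> 0"
    by (simp add: r_def)
  have ee: "e1 \<bullet> e1 = 1" "e2 \<bullet> e2 = 1" "e2 \<bullet> e1 = 0"
    using e by (simp_all add: power2_norm_eq_inner[symmetric] inner_commute)
  then have r: "r \<bullet> e1 = 0" "r \<bullet> e2 = 0" "e1 \<bullet> r = 0" "e2 \<bullet> r = 0"
    using e(3) by (simp_all add: r_def inner_diff_left inner_diff_right inner_add_left inner_add_right inner_commute)
  have "e1 \<noteq> e2" "e1 \<noteq> r" "e2 \<noteq> r"
    using ee e(3) r by auto
  then have "card {e1, e2, r} = 3"
    by simp
  moreover have "independent {e1, e2, r}"
    using e(3) ee r \<open>r \<noteq> 0\<close>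
    by (intro pairwise_orthogonal_independent) (auto simp: pairwise_def orthogonal_def)
  then have "card {e1, e2, r} \<le> DIM('a)"
    using independent_card_le by blast
  ultimately show False
    using dim by simp
qed

lemma sine_bracket_plane:
  fixes e1 e2 :: "'a::euclidean_space"
  assumes "norm e1 = 1" "norm e2 = 1" "e1 \<bullet> e2 = 0"
  shows "sine_bracket (a *\<^sub>R e1 + b *\<^sub>R e2) (c *\<^sub>R e1 + d *\<^sub>R e2) = \<bar>a * d - b * c\<bar>"
proof -
  have "(sine_bracket (a *\<^sub>R e1 + b *\<^sub>R e2) (c *\<^sub>R e1 + d *\<^sub>R e2))\<^sup>2
      = (sine_bracket (a *\<^sub>R e1) (c *\<^sub>R e1))\<^sup>2 + (norm (b *\<^sub>R c *\<^sub>R e1 - d *\<^sub>R a *\<^sub>R e1))\<^sup>2"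
    using assms by (intro sine_bracket_split_square) auto
  also have "sine_bracket (a *\<^sub>R e1) (c *\<^sub>R e1) = 0"
    by simp
  also have "b *\<^sub>R c *\<^sub>R e1 - d *\<^sub>R a *\<^sub>R e1 = (b * c - d * a) *\<^sub>R e1"
    by (simp add: algebra_simps)
  also have "0\<^sup>2 + (norm ((b * c - d * a) *\<^sub>R e1))\<^sup>2 = \<bar>a * d - b * c\<bar>\<^sup>2"
    by (simp add: assms(1)) (simp add: power2_eq_square algebra_simps)
  finally show ?thesis
    by (rule power2_eq_imp_eq) auto
qed

text \<open>Upper boundary points \<open>z\<close> are paired with the point \<open>p = pt 1 0\<close>, where the inscribed disc touches and the
  contact partner \<open>B\<close> is known. The partner \<open>A\<close> of \<open>z\<close> differs from \<open>B\<close> by a multiple of \<open>z - p\<close>, which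
  determines \<open>A\<close>; the claim is \<open>[A, pt c d] \<le> 1\<close>.\<close>
lemma sine_maximal_plane_slope:
  fixes K L :: "'a::euclidean_space set"
  assumes dim: "DIM('a) = 2" and R: "0 < R" and max: "sine_maximal R K L"
    and e: "norm e1 = 1" "norm e2 = 1" "e1 \<bullet> e2 = 0"
    and \<rho>: "0 < \<rho>" "cball 0 \<rho> \<subseteq> K" "\<rho> *\<^sub>R e1 \<in> K" "\<rho> *\<^sub>R e1 \<notin> interior K"
    and pt: "\<And>a b. pt a b = \<rho> *\<^sub>R (a *\<^sub>R e1 + b *\<^sub>R e2)"
    and a: "\<bar>a\<bar> < 1" and b: "0 < b" "pt a b \<in> K" "\<And>b'. pt a b' \<in> K \<Longrightarrow> b' \<le> b"
    and cd: "pt c d \<in> K"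
  shows "a * c + (1 - a\<^sup>2) / b * d \<le> 1"
proof -
  note K = sine_maximal_body[OF R max]
  have ee: "e1 \<bullet> e1 = 1" "e2 \<bullet> e2 = 1" "e2 \<bullet> e1 = 0"
    using e by (simp_all add: power2_norm_eq_inner[symmetric] inner_commute)
  define p where "p = \<rho> *\<^sub>R e1"
  have p_touch: "cball 0 \<rho> \<subseteq> K" "0 < \<rho>" "dist 0 p = \<rho>"
    using \<rho> e by (auto simp: p_def)
  have p: "p \<in> K" "p \<notin> interior K"
    using \<rho> by (simp_all add: p_def)
  have normal: "n = (norm n / \<rho>) *\<^sub>R p" if "\<And>w. w \<in> K \<Longrightarrow> n \<bullet> w \<le> n \<bullet> p" for n
    using normal_at_touching_point[OF p_touch that] by simp
  \<comment> \<open>The inscribed disc touches at \<open>p\<close>, so every outer normal at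
    \<open>p\<close> is a nonnegative multiple of \<open>p\<close>.\<close>
  have p_sup: "p \<bullet> w \<le> p \<bullet> p" if "w \<in> K" for w
  proof -
    obtain n where n: "n \<noteq> 0" "\<And>w. w \<in> K \<Longrightarrow> n \<bullet> w \<le> n \<bullet> p"
      using supporting_normal[of K p] K p by blast
    then have "n = (norm n / \<rho>) *\<^sub>R p"
      using normal by blast
    then have "(norm n / \<rho>) * (p \<bullet> w) \<le> (norm n / \<rho>) * (p \<bullet> p)"
      using n(2)[OF that] by (metis inner_scaleR_left)
    then show ?thesis
      using n(1) \<rho>(1) by (simp add: divide_le_cancel zero_less_mult_iff)
  qed
  define z where "z = pt a b"
  have z: "z \<in> K"
    using b by (simp add: z_def)
  have z_out: "z \<notin> interior K"
  proof
    assume "z \<in> interior K"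
    then obtain \<epsilon> where \<epsilon>: "0 < \<epsilon>" "cball z \<epsilon> \<subseteq> K"
      using mem_interior_cball by blast
    have "pt a (b + \<epsilon> / \<rho>) = z + \<epsilon> *\<^sub>R e2"
      using \<rho>(1) by (simp add: z_def pt algebra_simps)
    also have "\<dots> \<in> K"
      using \<epsilon> e by (intro subsetD[OF \<epsilon>(2)]) (auto simp: dist_norm)
    finally have "b + \<epsilon> / \<rho> \<le> b"
      by (rule b(3))
    moreover have "0 < \<epsilon> / \<rho>"
      using \<epsilon>(1) \<rho>(1) by simp
    ultimately show False
      by linarith
  qed
  have pp: "p \<bullet> p = \<rho>\<^sup>2" "p \<bullet> z = \<rho>\<^sup>2 * a"
    by (simp_all add: p_def z_def pt inner_add_right ee e power2_eq_square)
  have seg: "0 \<le> s \<and> s \<le> 1" if s: "p + s *\<^sub>R (z - p) \<in> K" for s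
  proof
    have "\<rho>\<^sup>2 * (s * (a - 1)) \<le> 0"
      using p_sup[OF s] by (simp add: inner_add_right inner_diff_right pp algebra_simps)
    then show "0 \<le> s"
      using a \<rho>(1) by (auto simp: mult_le_0_iff)
    show "s \<le> 1"
    proof (rule ccontr)
      \<comment> \<open>If the chord went beyond \<open>z\<close>, a normal \<open>g\<close> at
        \<open>z\<close> would be constant along it and hence also normal at \<open>p\<close>. Then
        \<open>g\<close> would be parallel to \<open>p\<close>, contrary to
        \<open>p \<bullet> z < p \<bullet> p\<close>.\<close>
      assume "\<not> s \<le> 1"
      obtain g where g: "g \<noteq> 0" "\<And>w. w \<in> K \<Longrightarrow> g \<bullet> w \<le> g \<bullet> z"
        using supporting_normal[of K z] K z_out by blast
      have "(s - 1) * (g \<bullet> z - g \<bullet> p) \<le> 0"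
        using g(2)[OF s] by (simp add: inner_add_right inner_diff_right algebra_simps)
      then have "g \<bullet> z = g \<bullet> p"
        using g(2)[OF p(1)] \<open>\<not> s \<le> 1\<close> by (auto simp: mult_le_0_iff)
      with g(2) have "g = (norm g / \<rho>) *\<^sub>R p"
        using normal by simp
      then have "(norm g / \<rho>) * (p \<bullet> z) = (norm g / \<rho>) * (p \<bullet> p)"
        using \<open>g \<bullet> z = g \<bullet> p\<close> by (metis inner_scaleR_left)
      then show False
        using g(1) \<rho>(1) a by (simp add: pp)
    qed
  qed
  have "z \<noteq> p"
    using pp a \<rho>(1) by auto
  define N where "N = norm (z - p)"
  have N: "0 < N"
    using \<open>z \<noteq> p\<close> by (simp add: N_def)
  define u where "u = (1 / N) *\<^sub>R (z - p)"
  have u: "norm u = 1" "z = p + N *\<^sub>R u"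
    using N by (simp_all add: u_def) (simp add: N_def)
  define k where "k = p \<bullet> u"
  define y where "y = p - k *\<^sub>R u"
  have "u \<bullet> u = 1"
    using u(1) by (simp add: power2_norm_eq_inner[symmetric])
  then have yu: "y \<bullet> u = 0"
    by (simp add: y_def k_def inner_diff_left)
  have y: "y + s *\<^sub>R u = p + ((s - k) / N) *\<^sub>R (z - p)" for s
    by (simp add: y_def u_def diff_divide_distrib algebra_simps)
  define m h where "m = k + N / 2" and "h = N / 2"
  have mh: "m + h = k + N" "m - h = k"
    by (simp_all add: m_def h_def)
  have yz: "y + (m + h) *\<^sub>R u = z" "y + (m - h) *\<^sub>R u = p"
    unfolding mh using u(2) by (simp_all add: y_def algebra_simps)
  obtain x M t where x0: "x + (M + t) *\<^sub>R u \<in> L" "x + (M - t) *\<^sub>R u \<in> L"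
    "sine_bracket (x + (M + t) *\<^sub>R u) (y + (m + h) *\<^sub>R u) = 1"
    "sine_bracket (x + (M - t) *\<^sub>R u) (y + (m - h) *\<^sub>R u) = 1"
  proof (rule sine_maximal_contact[OF _ R max u(1) yu, of m h])
    show "y + (m + h) *\<^sub>R u \<in> K" "y + (m - h) *\<^sub>R u \<in> K"
      unfolding yz using z p by simp_all
    show "a - b \<le> 2 * h" if "y + a *\<^sub>R u \<in> K" "y + b *\<^sub>R u \<in> K" for a b
    proof -
      have "(a - k) / N \<le> 1" "0 \<le> (b - k) / N"
        using that seg unfolding y by blast+
      then show ?thesis
        using N by (simp add: h_def field_simps)
    qed
  qed (use dim N h_def in auto)
  note x = x0[unfolded yz]
  define B where "B = x + (M - t) *\<^sub>R u"
  define \<tau> where "\<tau> = B \<bullet> e2"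
  define q where "q = 2 * t / N"
  obtain \<gamma> where "(norm B)\<^sup>2 *\<^sub>R p - (B \<bullet> p) *\<^sub>R B = \<gamma> *\<^sub>R (p - 0)"
    using contact_at_touching_point[OF K(5) x(2)[folded B_def] x(4)[folded B_def] p_touch] by blast
  then have B_par: "(B \<bullet> p) *\<^sub>R B = ((norm B)\<^sup>2 - \<gamma>) *\<^sub>R p"
    by (simp add: algebra_simps)
  \<comment> \<open>The contact normal at \<open>p\<close> is a multiple of \<open>p\<close>. With
    \<open>B \<bullet> p\<close> nonzero this would make \<open>B\<close> parallel to
    \<open>p\<close>, so that their bracket would vanish.\<close>
  have "B \<bullet> p = 0"
  proof (rule ccontr)
    assume "B \<bullet> p \<noteq> 0"
    then have "B = (((norm B)\<^sup>2 - \<gamma>) / (B \<bullet> p)) *\<^sub>R p"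
      using arg_cong[OF B_par, of "\<lambda>z. (1 / (B \<bullet> p)) *\<^sub>R z"] by simp
    then have "sine_bracket B p = \<bar>((norm B)\<^sup>2 - \<gamma>) / (B \<bullet> p)\<bar> * sine_bracket p p"
      by (metis sine_bracket_scaleR(2))
    then show False
      using x(4) by (simp add: B_def)
  qed
  then have "B \<bullet> e1 = 0"
    using \<rho>(1) by (simp add: p_def)
  then have B: "B = 0 *\<^sub>R e1 + \<tau> *\<^sub>R e2"
    using orthonormal_plane_expansion[OF dim e, of B] by (simp add: \<tau>_def)
  have Mt: "M + t = (M - t) + q * N"
    using N by (simp add: q_def)
  have "x + (M + t) *\<^sub>R u = B + (q * N) *\<^sub>R u"
    unfolding Mt B_def scaleR_add_left by (simp add: add.assoc)
  also have "\<dots> = (q * \<rho> * (a - 1)) *\<^sub>R e1 + (\<tau> + q * \<rho> * b) *\<^sub>R e2"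
    using N unfolding B by (simp add: u_def z_def pt p_def algebra_simps)
  finally have A: "x + (M + t) *\<^sub>R u = (q * \<rho> * (a - 1)) *\<^sub>R e1 + (\<tau> + q * \<rho> * b) *\<^sub>R e2" .
  have pt': "pt a b = (\<rho> * a) *\<^sub>R e1 + (\<rho> * b) *\<^sub>R e2" for a b
    by (simp add: pt algebra_simps)
  have A_le: "\<bar>q * \<rho> * (a - 1) * (\<rho> * d) - (\<tau> + q * \<rho> * b) * (\<rho> * c)\<bar> \<le> 1" if "pt c d \<in> K" for c d
  proof -
    have "sine_bracket (x + (M + t) *\<^sub>R u) (pt c d) \<le> 1"
      using K(5) x(1) that by (auto simp: subset_sine_polar_iff)
    then show ?thesis
      unfolding A pt' sine_bracket_plane[OF e] .
  qed
  have "sine_bracket B (\<rho> *\<^sub>R e1 + 0 *\<^sub>R e2) = 1"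
    using x(4) by (simp add: B_def p_def)
  then have \<tau>: "\<bar>\<tau> * \<rho>\<bar> = 1"
    unfolding B sine_bracket_plane[OF e] by simp
  have "\<bar>q * \<rho> * (a - 1) * (\<rho> * b) - (\<tau> + q * \<rho> * b) * (\<rho> * a)\<bar> = 1"
    using x(3) unfolding A z_def pt' sine_bracket_plane[OF e] .
  moreover have "q * \<rho> * (a - 1) * (\<rho> * b) - (\<tau> + q * \<rho> * b) * (\<rho> * a) = - (q * \<rho>\<^sup>2 * b) - \<tau> * \<rho> * a"
    by (simp add: algebra_simps power2_eq_square)
  ultimately have z1: "\<bar>q * \<rho>\<^sup>2 * b + \<tau> * \<rho> * a\<bar> = 1"
    by linarith
  have "pt 1 0 \<in> K"
    using p by (simp add: pt p_def)
  from A_le[OF this] have p1: "\<bar>\<tau> * \<rho> + q * \<rho>\<^sup>2 * b\<bar> \<le> 1"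
    by (simp add: algebra_simps power2_eq_square)
  \<comment> \<open>The other solution of \<open>z1\<close>, namely
    \<open>q * \<rho>\<^sup>2 * b = \<tau> * \<rho> * (1 - a)\<close>, gives the value
    \<open>2 - a > 1\<close> in \<open>p1\<close>.\<close>
  have q: "q * \<rho>\<^sup>2 * b = - (\<tau> * \<rho>) * (1 + a)"
  proof -
    consider "\<tau> * \<rho> = 1" | "\<tau> * \<rho> = - 1"
      using \<tau> by linarith
    then show ?thesis
    proof cases
      case 1
      then show ?thesis using z1 p1 a by (simp add: abs_if split: if_splits)
    next
      case 2
      then show ?thesis using z1 p1 a by (simp add: abs_if split: if_splits)
    qed
  qed
  have "\<bar>\<tau> * \<rho> * (a * c + (1 - a\<^sup>2) / b * d)\<bar> \<le> 1"
  proof -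
    have q': "q * \<rho>\<^sup>2 = - (\<tau> * \<rho>) * (1 + a) / b"
      using q b(1) by (simp add: field_simps)
    have "q * \<rho> * (a - 1) * (\<rho> * d) - (\<tau> + q * \<rho> * b) * (\<rho> * c)
        = (q * \<rho>\<^sup>2) * (a - 1) * d - \<tau> * \<rho> * c - (q * \<rho>\<^sup>2 * b) * c"
      by (simp add: algebra_simps power2_eq_square)
    also have "\<dots> = \<tau> * \<rho> * (a * c + (1 - a\<^sup>2) / b * d)"
      unfolding q unfolding q' using b(1) by (simp add: field_simps power2_eq_square)
    finally show ?thesis
      using A_le[OF cd] by simp
  qed
  then show ?thesis
    using \<tau> by (simp add: abs_mult)
qed

section \<open>From the slope inequality to an ellipse\<close>

lemma ratio_bound_imp_quadratic:
  fixes a b c d :: real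
  assumes a: "\<bar>a\<bar> < 1" and c: "\<bar>c\<bar> < 1" and b: "0 < b" "0 < d"
    and le: "a * c + (1 - a\<^sup>2) / b * d \<le> 1"
  shows "d\<^sup>2 / (1 - c\<^sup>2) - b\<^sup>2 / (1 - a\<^sup>2) \<le> b\<^sup>2 / (1 - a\<^sup>2) * ((a - c)\<^sup>2 / ((1 - a\<^sup>2) * (1 - c\<^sup>2)))"
proof -
  have pos: "0 < 1 - a\<^sup>2" "0 < 1 - c\<^sup>2"
    using a c by (simp_all add: abs_square_less_1)
  have "(1 - a\<^sup>2) * d \<le> b * (1 - a * c)"
    using le b by (simp add: field_simps)
  then have "((1 - a\<^sup>2) * d)\<^sup>2 \<le> (b * (1 - a * c))\<^sup>2"
    using pos b by (intro power_mono) auto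
  \<comment> \<open>The identity \<open>(1 - a * c)\<^sup>2 = (1 - a\<^sup>2) * (1 - c\<^sup>2) + (a
    - c)\<^sup>2\<close> leaves an error quadratic in \<open>a - c\<close>.\<close>
  also have "\<dots> = b\<^sup>2 * ((1 - a\<^sup>2) * (1 - c\<^sup>2) + (a - c)\<^sup>2)"
    by (simp add: power2_eq_square algebra_simps)
  finally have "(1 - a\<^sup>2)\<^sup>2 * d\<^sup>2 / ((1 - a\<^sup>2)\<^sup>2 * (1 - c\<^sup>2))
      \<le> b\<^sup>2 * ((1 - a\<^sup>2) * (1 - c\<^sup>2) + (a - c)\<^sup>2) / ((1 - a\<^sup>2)\<^sup>2 * (1 - c\<^sup>2))"
    using pos by (intro divide_right_mono) (auto simp: power_mult_distrib)
  also have "(1 - a\<^sup>2)\<^sup>2 * d\<^sup>2 / ((1 - a\<^sup>2)\<^sup>2 * (1 - c\<^sup>2)) = d\<^sup>2 / (1 - c\<^sup>2)"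
    using pos by simp
  also have "b\<^sup>2 * ((1 - a\<^sup>2) * (1 - c\<^sup>2) + (a - c)\<^sup>2) / ((1 - a\<^sup>2)\<^sup>2 * (1 - c\<^sup>2))
      = b\<^sup>2 / (1 - a\<^sup>2) + b\<^sup>2 / (1 - a\<^sup>2) * ((a - c)\<^sup>2 / ((1 - a\<^sup>2) * (1 - c\<^sup>2)))"
  proof -
    have "b\<^sup>2 * (A * C + D) / (A\<^sup>2 * C) = b\<^sup>2 / A + b\<^sup>2 / A * (D / (A * C))"
      if "0 < A" "0 < C" for A C D :: real
      using that by (simp add: field_simps power2_eq_square)
    then show ?thesis
      using pos by blast
  qed
  finally show ?thesis
    by simp
qed

text \<open>The function \<open>b\<close> describes the upper boundary of a planar maximiser in the coordinates of a
  point where it touches its inscribed disc.\<close>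
lemma profile_ratio_constant:
  fixes b :: "real \<Rightarrow> real"
  assumes pos: "\<And>a. \<bar>a\<bar> < 1 \<Longrightarrow> 0 < b a" and bdd: "\<And>a. \<bar>a\<bar> < 1 \<Longrightarrow> b a \<le> C"
    and slope: "\<And>a c. \<bar>a\<bar> < 1 \<Longrightarrow> \<bar>c\<bar> < 1 \<Longrightarrow> a * c + (1 - a\<^sup>2) / b a * b c \<le> 1"
    and a: "\<bar>a\<bar> < 1"
  shows "(b a)\<^sup>2 = (b 0)\<^sup>2 * (1 - a\<^sup>2)"
proof -
  \<comment> \<open>Constancy of this quotient is the equation of an ellipse. On \<open>S\<close>
    the denominator is at least \<open>r\<close>, which makes the quadratic bound for the increments
    uniform.\<close>
  define f where "f a = (b a)\<^sup>2 / (1 - a\<^sup>2)" for a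
  define r where "r = 1 - a\<^sup>2"
  define S where "S = {- \<bar>a\<bar>..\<bar>a\<bar>}"
  have r: "0 < r"
    using a by (simp add: r_def abs_square_less_1)
  have S: "\<bar>x\<bar> < 1" "r \<le> 1 - x\<^sup>2" if "x \<in> S" for x
    using that a abs_le_square_iff[of x a] by (auto simp: S_def r_def)
  have one: "f y - f x \<le> C\<^sup>2 / r * (1 / (r * r)) * (y - x)\<^sup>2" if x: "x \<in> S" and y: "y \<in> S" for x y
  proof -
    have "f y - f x \<le> f x * ((x - y)\<^sup>2 / ((1 - x\<^sup>2) * (1 - y\<^sup>2)))"
      unfolding f_def using S(1)[OF x] S(1)[OF y] by (intro ratio_bound_imp_quadratic pos slope)
    also have "\<dots> \<le> C\<^sup>2 / r * ((x - y)\<^sup>2 / (r * r))"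
    proof (intro mult_mono)
      show "f x \<le> C\<^sup>2 / r"
        unfolding f_def using S[OF x] r pos[of x] bdd[of x]
        by (intro frac_le power_mono) auto
      show "(x - y)\<^sup>2 / ((1 - x\<^sup>2) * (1 - y\<^sup>2)) \<le> (x - y)\<^sup>2 / (r * r)"
        using S[OF x] S[OF y] r by (intro divide_left_mono mult_mono mult_pos_pos) auto
      show "0 \<le> (x - y)\<^sup>2 / ((1 - x\<^sup>2) * (1 - y\<^sup>2))"
        using S[OF x] S[OF y] r by (intro divide_nonneg_nonneg mult_nonneg_nonneg) auto
    qed (use r in auto)
    finally show ?thesis
      by (simp add: power2_commute)
  qed
  have "f a = f 0"
  proof (rule quadratic_modulus_imp_constant[where f = f and C = "C\<^sup>2 / r * (1 / (r * r))"])
    show "convex S"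
      by (simp add: S_def)
    show "\<bar>f y - f x\<bar> \<le> C\<^sup>2 / r * (1 / (r * r)) * (y - x)\<^sup>2" if "x \<in> S" "y \<in> S" for x y
      using one[OF that] one[OF that(2,1)] by (simp add: abs_le_iff power2_commute)
  qed (auto simp: S_def)
  then show ?thesis
    using r by (simp add: f_def r_def field_simps)
qed

text \<open>With \<open>e1\<close> pointing to a boundary point nearest to \<open>0\<close>, the
  upper boundary is a graph \<open>b\<close> over the open unit interval
  \<open>\<bar>a\<bar> < 1\<close>. The slope inequality makes it half an ellipse, and central
  symmetry supplies the lower half.\<close>

lemma sine_maximal_plane_shape:
  fixes K L :: "'a::euclidean_space set"
  assumes dim: "DIM('a) = 2" and R: "0 < R" and max: "sine_maximal R K L"
  obtains e1 e2 :: 'a and \<rho> s where "norm e1 = 1" "norm e2 = 1" "e1 \<bullet> e2 = 0" "0 < \<rho>" "0 < s"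
    "K = (\<lambda>w. \<rho> *\<^sub>R ((w \<bullet> e1) *\<^sub>R e1 + (s * (w \<bullet> e2)) *\<^sub>R e2)) ` cball 0 1"
proof -
  note K = sine_maximal_body[OF R max]
  obtain p \<rho> where p: "0 < \<rho>" "dist 0 p = \<rho>" "cball 0 \<rho> \<subseteq> K" "p \<in> K" "p \<notin> interior K"
    using touching_point[OF K(1-3)] by metis
  define e1 where "e1 = (1 / \<rho>) *\<^sub>R p"
  have p_eq: "p = \<rho> *\<^sub>R e1" and e1: "norm e1 = 1"
    using p(1,2) by (simp_all add: e1_def)
  obtain e2 where e2: "e1 \<bullet> e2 = 0" "norm e2 = 1"
    using exists_orthogonal_unit[of e1] dim by auto
  note e = e1 e2(2,1)
  have ee: "e1 \<bullet> e1 = 1" "e2 \<bullet> e2 = 1" "e2 \<bullet> e1 = 0"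
    using e by (simp_all add: power2_norm_eq_inner[symmetric] inner_commute)
  define pt where "pt a b = \<rho> *\<^sub>R (a *\<^sub>R e1 + b *\<^sub>R e2)" for a b
  have norm_pt: "(norm (pt a b))\<^sup>2 = \<rho>\<^sup>2 * (a\<^sup>2 + b\<^sup>2)" for a b
    unfolding power2_norm_eq_inner
    by (simp add: pt_def inner_add_left inner_add_right ee e(3) power2_eq_square algebra_simps)
  have pt_in: "pt a b \<in> K" if "a\<^sup>2 + b\<^sup>2 \<le> 1" for a b
  proof -
    have "(norm (pt a b))\<^sup>2 \<le> \<rho>\<^sup>2"
      unfolding norm_pt using that by (simp add: mult_left_le)
    then have "norm (pt a b) \<le> \<rho>"
      using p(1) power2_le_imp_le by auto
    then show ?thesis
      using p(3) by auto
  qed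
  have pt_minus: "pt (- a) (- b) \<in> K" if "pt a b \<in> K" for a b
    using K(4)[OF that] by (simp add: pt_def algebra_simps)
  have pt_convex: "pt ((1 - t) * a + t * a') ((1 - t) * b + t * b') \<in> K"
    if "pt a b \<in> K" "pt a' b' \<in> K" "0 \<le> t" "t \<le> 1" for a b a' b' t
    using convexD_alt[OF K(2) that] by (simp add: pt_def algebra_simps)
  have pt_scale: "pt (t * a) (t * b) \<in> K" if "pt a b \<in> K" "0 \<le> t" "t \<le> 1" for a b t
    using pt_convex[OF pt_in[of 0 0] that] by simp
  obtain B where B: "\<And>w. w \<in> K \<Longrightarrow> norm w \<le> B"
    using compact_imp_bounded[OF K(1)] bounded_iff by blast
  have le1: "a \<le> 1" if "pt a b \<in> K" for a b
  proof -
    obtain n where n: "n \<noteq> 0" "\<And>w. w \<in> K \<Longrightarrow> n \<bullet> w \<le> n \<bullet> p"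
      using supporting_normal[of K p] K p by blast
    have "n = (norm n / \<rho>) *\<^sub>R p"
      using normal_at_touching_point[OF p(3,1,2) n(2)] by simp
    then have "(norm n / \<rho>) * (p \<bullet> pt a b) \<le> (norm n / \<rho>) * (p \<bullet> p)"
      using n(2)[OF that] by (metis inner_scaleR_left)
    then have "p \<bullet> pt a b \<le> p \<bullet> p"
      using n(1) p(1) by (simp add: divide_le_cancel zero_less_mult_iff)
    then have "\<rho>\<^sup>2 * a \<le> \<rho>\<^sup>2 * 1"
      by (simp add: p_eq pt_def inner_add_right ee e(3) power2_eq_square mult_ac)
    then show ?thesis
      using p(1) by simp
  qed
  have abs_le1: "\<bar>a\<bar> \<le> 1" if "pt a b \<in> K" for a b
    using le1[OF that] le1[OF pt_minus[OF that]] by simp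
  have "\<exists>b. 0 < b \<and> pt a b \<in> K \<and> (\<forall>b'. pt a b' \<in> K \<longrightarrow> b' \<le> b)" if a: "\<bar>a\<bar> < 1" for a
  proof -
    have "pt a 0 \<in> K"
      using a by (intro pt_in) (simp add: abs_square_le_1)
    then obtain s where s: "0 \<le> s" "pt a 0 + s *\<^sub>R e2 \<in> K" "\<And>t. pt a 0 + t *\<^sub>R e2 \<in> K \<Longrightarrow> t \<le> s"
      using chord_end[OF K(1) _ e(2)] by blast
    have shift: "pt a 0 + t *\<^sub>R e2 = pt a (t / \<rho>)" for t
      using p(1) by (simp add: pt_def algebra_simps)
    have top: "b' \<le> s / \<rho>" if "pt a b' \<in> K" for b'
      using s(3)[of "\<rho> * b'"] that p(1) by (simp add: shift field_simps)
    have "0 < sqrt (1 - a\<^sup>2)"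
      using a by (simp add: abs_square_less_1)
    also have "\<dots> \<le> s / \<rho>"
      using a abs_square_less_1[of a] by (intro top pt_in) simp
    finally show ?thesis
      using s(2) top unfolding shift by blast
  qed
  then obtain b where b: "\<And>a. \<bar>a\<bar> < 1 \<Longrightarrow> 0 < b a" "\<And>a. \<bar>a\<bar> < 1 \<Longrightarrow> pt a (b a) \<in> K"
    "\<And>a b'. \<bar>a\<bar> < 1 \<Longrightarrow> pt a b' \<in> K \<Longrightarrow> b' \<le> b a"
    by metis
  define s where "s = b 0"
  have s: "0 < s"
    using b(1)[of 0] by (simp add: s_def)
  have b_sq: "(b a)\<^sup>2 = s\<^sup>2 * (1 - a\<^sup>2)" if "\<bar>a\<bar> < 1" for a
    unfolding s_def
  proof (rule profile_ratio_constant[OF b(1) _ _ that])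
    show "b a \<le> B / \<rho>" if "\<bar>a\<bar> < 1" for a
    proof -
      have "pt a (b a) \<bullet> e2 \<le> norm (pt a (b a))"
        using norm_cauchy_schwarz[of "pt a (b a)" e2] e by simp
      also have "\<dots> \<le> B"
        using B b(2)[OF that] by blast
      also have "pt a (b a) \<bullet> e2 = \<rho> * b a"
        by (simp add: pt_def inner_add_left ee e(3))
      finally show ?thesis
        using p(1) by (simp add: field_simps)
    qed
    show "a * c + (1 - a\<^sup>2) / b a * b c \<le> 1" if "\<bar>a\<bar> < 1" "\<bar>c\<bar> < 1" for a c
      by (rule sine_maximal_plane_slope[OF dim R max e p(1,3) _ _ pt_def that(1) b(1)[OF that(1)] b(2)[OF that(1)]
            b(3)[OF that(1)] b(2)[OF that(2)]])
        (use p(4,5) p_eq in auto)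
  qed
  have b_even: "b (- a) = b a" if "\<bar>a\<bar> < 1" for a
  proof (rule power2_eq_imp_eq)
    have neg: "\<bar>- a\<bar> < 1"
      using that by simp
    show "(b (- a))\<^sup>2 = (b a)\<^sup>2"
      unfolding b_sq[OF that] b_sq[OF neg] by simp
    show "0 \<le> b (- a)" "0 \<le> b a"
      using b(1)[OF neg] b(1)[OF that] by linarith+
  qed
  have "pt c d \<in> K \<longleftrightarrow> c\<^sup>2 + (d / s)\<^sup>2 \<le> 1" for c d
  proof
    assume cd: "pt c d \<in> K"
    \<comment> \<open>Scaling the point by \<open>sqrt z\<close> moves its abscissa into the open
      interval where the profile is known; the claim follows as \<open>z\<close> tends to
      one.\<close>
    have "z * (d\<^sup>2 + s\<^sup>2 * c\<^sup>2) \<le> s\<^sup>2" if z: "0 < z" "z < 1" for z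
    proof -
      define t where "t = sqrt z"
      have t: "0 \<le> t" "t < 1" "t\<^sup>2 = z"
        using z by (simp_all add: t_def)
      have tcd: "pt (t * c) (t * d) \<in> K"
        using pt_scale[OF cd] t by simp
      have "\<bar>t * c\<bar> \<le> t * 1"
        unfolding abs_mult using t abs_le1[OF cd] by (intro mult_mono) auto
      then have lt: "\<bar>t * c\<bar> < 1" "\<bar>- (t * c)\<bar> < 1"
        using t by simp_all
      have "t * d \<le> b (t * c)" "- (t * d) \<le> b (- (t * c))"
        using b(3)[OF lt(1) tcd] b(3)[OF lt(2) pt_minus[OF tcd]] by simp_all
      moreover have "b (- (t * c)) = b (t * c)"
        by (rule b_even[OF lt(1)])
      ultimately have "\<bar>t * d\<bar> \<le> \<bar>b (t * c)\<bar>"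
        by linarith
      then have "(t * d)\<^sup>2 \<le> (b (t * c))\<^sup>2"
        by (simp add: abs_le_square_iff)
      also have "\<dots> = s\<^sup>2 * (1 - (t * c)\<^sup>2)"
        by (rule b_sq[OF lt(1)])
      finally show ?thesis
        by (simp add: power_mult_distrib t(3) algebra_simps)
    qed
    then have "d\<^sup>2 + s\<^sup>2 * c\<^sup>2 \<le> s\<^sup>2"
      by (rule field_le_mult_one_interval)
    then show "c\<^sup>2 + (d / s)\<^sup>2 \<le> 1"
      using s by (simp add: power_divide field_simps)
  next
    assume le: "c\<^sup>2 + (d / s)\<^sup>2 \<le> 1"
    then have "c\<^sup>2 \<le> 1"
      using zero_le_power2[of "d / s"] by linarith
    then have "\<bar>c\<bar> \<le> 1"
      by (simp only: abs_square_le_1)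
    then consider "\<bar>c\<bar> < 1" | "\<bar>c\<bar> = 1"
      by linarith
    then show "pt c d \<in> K"
    proof cases
      case 1
      have "d\<^sup>2 \<le> s\<^sup>2 * (1 - c\<^sup>2)"
        using le s by (simp add: power_divide field_simps)
      then have "d\<^sup>2 \<le> (b c)\<^sup>2"
        using b_sq[OF 1] by simp
      then have d: "\<bar>d\<bar> \<le> b c"
        using b(1)[OF 1] by (simp flip: abs_le_square_iff)
      have lt': "\<bar>- c\<bar> < 1"
        using 1 by simp
      have low: "pt c (- b c) \<in> K"
        using pt_minus[OF b(2)[OF lt']] b_even[OF 1] by simp
      define t where "t = (d + b c) / (2 * b c)"
      have t: "0 \<le> t" "t \<le> 1"
        using d b(1)[OF 1] by (auto simp: t_def field_simps)
      have "(1 - t) * c + t * c = c" "(1 - t) * (- b c) + t * b c = d"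
        using b(1)[OF 1] by (simp_all add: t_def field_simps)
      then show ?thesis
        using pt_convex[OF low b(2)[OF 1] t] by simp
    next
      case 2
      then have "c\<^sup>2 = 1"
        by (metis one_power2 power2_abs)
      then have "d = 0"
        using le s by simp
      then show ?thesis
        using \<open>c\<^sup>2 = 1\<close> by (intro pt_in) simp
    qed
  qed
  note pt_iff = this
  let ?f = "\<lambda>w. \<rho> *\<^sub>R ((w \<bullet> e1) *\<^sub>R e1 + (s * (w \<bullet> e2)) *\<^sub>R e2)"
  have norm_sq: "(norm w)\<^sup>2 = (w \<bullet> e1)\<^sup>2 + (w \<bullet> e2)\<^sup>2" for w
  proof -
    have "(norm w)\<^sup>2 = w \<bullet> ((w \<bullet> e1) *\<^sub>R e1 + (w \<bullet> e2) *\<^sub>R e2)"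
      using orthonormal_plane_expansion[OF dim e, of w] by (simp add: power2_norm_eq_inner)
    then show ?thesis
      by (simp add: inner_add_right power2_eq_square)
  qed
  have in_ball: "w \<in> cball 0 1 \<longleftrightarrow> (w \<bullet> e1)\<^sup>2 + (w \<bullet> e2)\<^sup>2 \<le> 1" for w
    unfolding norm_sq[symmetric] by (simp add: abs_square_le_1)
  have "K = ?f ` cball 0 1"
  proof (intro equalityI subsetI)
    fix w assume w: "w \<in> K"
    define c d where "c = w \<bullet> e1 / \<rho>" and "d = w \<bullet> e2 / \<rho>"
    have w_eq: "w = pt c d"
      using orthonormal_plane_expansion[OF dim e, of w] p(1) by (simp add: pt_def c_def d_def algebra_simps)
    with w have cd: "c\<^sup>2 + (d / s)\<^sup>2 \<le> 1"
      using pt_iff by simp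
    define v where "v = c *\<^sub>R e1 + (d / s) *\<^sub>R e2"
    have v: "v \<bullet> e1 = c" "v \<bullet> e2 = d / s"
      by (simp_all add: v_def inner_add_left ee e(3))
    then have "v \<in> cball 0 1"
      using in_ball cd by simp
    moreover have "w = ?f v"
      using s by (simp add: v w_eq pt_def)
    ultimately show "w \<in> ?f ` cball 0 1"
      by blast
  next
    fix w assume "w \<in> ?f ` cball 0 1"
    then obtain v where v: "v \<in> cball 0 1" "w = ?f v"
      by blast
    have "w = pt (v \<bullet> e1) (s * (v \<bullet> e2))"
      by (simp add: v(2) pt_def)
    moreover have "(v \<bullet> e1)\<^sup>2 + (s * (v \<bullet> e2) / s)\<^sup>2 \<le> 1"
      using v(1) in_ball s by simp
    ultimately show "w \<in> K"
      using pt_iff by simp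
  qed
  then show ?thesis
    using that[OF e p(1) s] by blast
qed

section \<open>Linear images\<close>

text \<open>Uniqueness of Haar measure, in the form needed here: the measure \<open>A \<mapsto> \<lambda> (g -` A)\<close> is
  translation invariant, so both sides are the integral of
  \<open>indicator (cball 0 1) (g x) * indicator A (g x + y)\<close>.\<close>
lemma emeasure_linear_vimage:
  fixes f g :: "'a::euclidean_space \<Rightarrow> 'a"
  assumes g: "linear g" and gf: "\<And>y. g (f y) = y" and A[measurable]: "A \<in> sets borel"
  shows "emeasure lborel (g -` A) * emeasure lborel (cball 0 1 :: 'a set)
    = emeasure lborel (g -` cball 0 1) * emeasure lborel A"
proof -
  have g_cont: "continuous_on UNIV g"
    using g linear_continuous_on linear_linear by blast
  then have g_meas[measurable]: "g \<in> borel_measurable borel"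
    by (rule borel_measurable_continuous_onI)
  let ?B = "cball 0 1 :: 'a set"
  have B[measurable]: "?B \<in> sets borel"
    by (rule borel_closed) simp
  have vim: "emeasure lborel (g -` S) = (\<integral>\<^sup>+x. indicator S (g x) \<partial>lborel)" if [measurable]: "S \<in> sets borel" for S
  proof -
    have "g -` S \<in> sets lborel"
      using measurable_sets[OF g_meas that] by simp
    then have "emeasure lborel (g -` S) = (\<integral>\<^sup>+x. indicator (g -` S) x \<partial>lborel)"
      by simp
    also have "\<dots> = (\<integral>\<^sup>+x. indicator S (g x) \<partial>lborel)"
      by (intro nn_integral_cong) (auto simp: indicator_def)
    finally show ?thesis .
  qed
  have shift: "(\<integral>\<^sup>+y. indicator S (a + y) \<partial>lborel) = emeasure lborel S" if [measurable]: "S \<in> sets borel" for S and a :: 'a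
  proof -
    have "(\<integral>\<^sup>+y. indicator S (a + y) \<partial>lborel) = (\<integral>\<^sup>+y. indicator S y \<partial>distr lborel borel ((+) a))"
      by (subst nn_integral_distr) auto
    then show ?thesis
      by (simp add: lborel_distr_plus)
  qed
  have "emeasure lborel (g -` ?B) * emeasure lborel A
      = (\<integral>\<^sup>+x. (\<integral>\<^sup>+y. indicator ?B (g x) * indicator A (g x + y) \<partial>lborel) \<partial>lborel)"
    by (subst nn_integral_cmult) (simp_all add: vim shift nn_integral_multc)
  also have "\<dots> = (\<integral>\<^sup>+y. (\<integral>\<^sup>+x. indicator ?B (g x) * indicator A (g x + y) \<partial>lborel) \<partial>lborel)"
    by (rule lborel_pair.Fubini'[symmetric]) measurable
  \<comment> \<open>Substituting \<open>f y + x\<close> for \<open>x\<close> replaces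
    \<open>g x\<close> by \<open>y + g x\<close>; symmetry of the ball removes the remaining
    sign.\<close>
  also have "\<dots> = (\<integral>\<^sup>+y. (\<integral>\<^sup>+x. indicator ?B (y - g x) * indicator A (g x) \<partial>lborel) \<partial>lborel)"
  proof (rule nn_integral_cong)
    fix y :: 'a
    have "(\<integral>\<^sup>+x. indicator ?B (y - g x) * indicator A (g x) \<partial>lborel)
        = (\<integral>\<^sup>+x. indicator ?B (y - g x) * indicator A (g x) \<partial>distr lborel borel ((+) (f y)))"
      by (simp add: lborel_distr_plus)
    also have "\<dots> = (\<integral>\<^sup>+x. indicator ?B (y - g (f y + x)) * indicator A (g (f y + x)) \<partial>lborel)"
      by (rule nn_integral_distr) (simp, measurable)
    also have "\<dots> = (\<integral>\<^sup>+x. indicator ?B (g x) * indicator A (g x + y) \<partial>lborel)"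
      by (intro nn_integral_cong) (simp add: linear_add[OF g] gf indicator_def add.commute)
    finally show "(\<integral>\<^sup>+x. indicator ?B (g x) * indicator A (g x + y) \<partial>lborel)
        = (\<integral>\<^sup>+x. indicator ?B (y - g x) * indicator A (g x) \<partial>lborel)"
      by simp
  qed
  also have "\<dots> = (\<integral>\<^sup>+x. (\<integral>\<^sup>+y. indicator ?B (y - g x) * indicator A (g x) \<partial>lborel) \<partial>lborel)"
    by (rule lborel_pair.Fubini') measurable
  also have "\<dots> = (\<integral>\<^sup>+x. emeasure lborel ?B * indicator A (g x) \<partial>lborel)"
  proof (rule nn_integral_cong)
    fix x :: 'a
    show "(\<integral>\<^sup>+y. indicator ?B (y - g x) * indicator A (g x) \<partial>lborel) = emeasure lborel ?B * indicator A (g x)"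
      using shift[OF B, of "- g x"] by (subst nn_integral_multc) (auto, measurable)
  qed
  also have "\<dots> = emeasure lborel (g -` A) * emeasure lborel ?B"
    by (subst nn_integral_cmult) (auto simp: vim mult.commute, measurable)
  finally show ?thesis
    by simp
qed

lemma compact_linear_image:
  fixes f :: "'a::euclidean_space \<Rightarrow> 'b::real_normed_vector"
  assumes "linear f" "compact A"
  shows "compact (f ` A)"
  using assms compact_continuous_image linear_continuous_on linear_conv_bounded_linear by blast

text \<open>This is the absolute value of the determinant, read off from the volume of the image of
  the unit ball.\<close>

definition volume_factor :: "('a::euclidean_space \<Rightarrow> 'a) \<Rightarrow> real" where
  "volume_factor f = measure lebesgue (f ` cball 0 1) / measure lebesgue (cball (0::'a) 1)"

lemma measure_linear_image_compact:
  fixes f :: "'a::euclidean_space \<Rightarrow> 'a"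
  assumes f: "linear f" "inj f" and A: "compact A"
  shows "measure lebesgue (f ` A) = volume_factor f * measure lebesgue A"
proof -
  obtain g where g: "linear g" "g \<circ> f = id" "f \<circ> g = id"
    using linear_injective_isomorphism[OF f] by (auto simp: fun_eq_iff)
  then have gf: "g (f y) = y" "f (g y) = y" for y
    by (auto simp: fun_eq_iff)
  then have "x \<in> f ` S \<longleftrightarrow> x \<in> g -` S" for x S
    by (metis image_iff vimage_eq)
  then have im: "f ` S = g -` S" for S
    by blast
  have cpt: "compact (f ` S)" if "compact S" for S
    using that f(1) by (simp add: compact_linear_image)
  have meas: "measure lebesgue S = measure lborel S" if "compact S" for S :: "'a set"
    using that by (auto simp: measure_completion borel_closed compact_imp_closed)
  let ?B = "cball 0 1 :: 'a set"
  have "A \<in> sets borel"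
    using A by (auto intro: borel_closed compact_imp_closed)
  from emeasure_linear_vimage[OF g(1) gf(1) this]
  have "measure lborel (f ` A) * measure lborel ?B = measure lborel (f ` ?B) * measure lborel A"
    unfolding im[symmetric] measure_def by (simp flip: enn2real_mult)
  then show ?thesis
    using content_cball_pos[of 1 "0::'a"]
    by (simp add: volume_factor_def meas cpt A field_simps)
qed

lemma volume_factor_pos:
  fixes f :: "'a::euclidean_space \<Rightarrow> 'a"
  assumes "linear f" "inj f"
  shows "0 < volume_factor f"
proof -
  obtain g where g: "linear g" "f \<circ> g = id" "g \<circ> f = id"
    using linear_injective_isomorphism[OF assms] by (auto simp: fun_eq_iff)
  have "inj g"
    using g(2) by (metis inj_on_id inj_on_imageI2)
  have "compact (g ` cball 0 1)"
    using g(1) by (simp add: compact_linear_image)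
  from measure_linear_image_compact[OF assms this]
  have "measure lebesgue (cball (0::'a) 1) = volume_factor f * measure lebesgue (g ` cball 0 1)"
    using g(2) by (simp add: image_image fun_eq_iff)
  moreover have "0 < measure lebesgue (cball (0::'a) 1)"
    using content_cball_pos[of 1 "0::'a"] by simp
  ultimately show ?thesis
    by (metis measure_nonneg mult_not_zero not_less zero_less_mult_pos2 order_less_le)
qed

lemma volume_factor_comp:
  fixes f g :: "'a::euclidean_space \<Rightarrow> 'a"
  assumes "linear f" "inj f" "linear g" "inj g"
  shows "volume_factor (\<lambda>x. f (g x)) = volume_factor f * volume_factor g"
proof -
  have "compact (g ` cball 0 1)"
    using assms(3) by (simp add: compact_linear_image)
  from measure_linear_image_compact[OF assms(1,2) this] show ?thesis
    by (simp add: volume_factor_def image_image)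
qed

lemma volume_factor_scaleR:
  assumes "0 < k"
  shows "volume_factor (\<lambda>x::'a::euclidean_space. k *\<^sub>R x) = k ^ DIM('a)"
proof -
  have "(\<lambda>x::'a. k *\<^sub>R x) ` cball 0 1 = cball 0 k"
    using cball_scale[of k 0 1] assms by simp
  moreover have "unit_ball_vol (real DIM('a)) \<noteq> 0"
    by (metis less_irrefl of_nat_0_le_iff unit_ball_vol_pos)
  ultimately show ?thesis
    using assms by (simp add: volume_factor_def content_cball)
qed

section \<open>Linear maps of the plane and polars of ellipses\<close>

lemma sine_bracket_linear_image_plane:
  fixes f :: "'a::euclidean_space \<Rightarrow> 'a"
  assumes dim: "DIM('a) = 2" and f: "linear f" "inj f"
  obtains D where "0 < D" "\<And>x y. sine_bracket (f x) (f y) = D * sine_bracket x y"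
proof -
  obtain e1 :: 'a where e1: "norm e1 = 1"
    using vector_choose_size[of 1] by auto
  obtain e2 where e2: "e1 \<bullet> e2 = 0" "norm e2 = 1"
    using exists_orthogonal_unit[of e1] dim by auto
  note e = e1 e2(2,1)
  \<comment> \<open>In orthonormal coordinates of the plane the bracket is the absolute value of a
    determinant. By multiplicativity its scaling factor is the absolute determinant of
    \<open>f\<close>, which is this value.\<close>
  define D where "D = sine_bracket (f e1) (f e2)"
  obtain a b c d where fe: "f e1 = a *\<^sub>R e1 + b *\<^sub>R e2" "f e2 = c *\<^sub>R e1 + d *\<^sub>R e2"
    using orthonormal_plane_expansion[OF dim e] by metis
  have D: "D = \<bar>a * d - b * c\<bar>"
    unfolding D_def fe by (rule sine_bracket_plane[OF e])
  have "sine_bracket (f x) (f y) = D * sine_bracket x y" for x y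
  proof -
    obtain x1 x2 where x: "x = x1 *\<^sub>R e1 + x2 *\<^sub>R e2"
      using orthonormal_plane_expansion[OF dim e] by metis
    obtain y1 y2 where y: "y = y1 *\<^sub>R e1 + y2 *\<^sub>R e2"
      using orthonormal_plane_expansion[OF dim e] by metis
    have "f (s *\<^sub>R e1 + t *\<^sub>R e2) = (s * a + t * c) *\<^sub>R e1 + (s * b + t * d) *\<^sub>R e2" for s t
      by (simp add: linear_add[OF f(1)] linear_cmul[OF f(1)] fe algebra_simps)
    then have "sine_bracket (f x) (f y)
        = \<bar>(x1 * a + x2 * c) * (y1 * b + y2 * d) - (x1 * b + x2 * d) * (y1 * a + y2 * c)\<bar>"
      by (simp only: x y sine_bracket_plane[OF e])
    also have "\<dots> = \<bar>(a * d - b * c) * (x1 * y2 - x2 * y1)\<bar>"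
      by (simp add: algebra_simps)
    finally show ?thesis
      by (simp add: D x y sine_bracket_plane[OF e] abs_mult)
  qed
  moreover have "D \<noteq> 0"
  proof
    assume "D = 0"
    have "f e1 \<noteq> 0"
      using f e1 by (metis linear_0 injD norm_zero zero_neq_one)
    then obtain k where "f e2 = k *\<^sub>R f e1"
      using sine_bracket_eq_0D[of "f e1" "f e2"] \<open>D = 0\<close> by (auto simp: D_def)
    then have "e2 = k *\<^sub>R e1"
      using f by (metis linear_cmul injD)
    then have "e2 \<bullet> e2 = 0"
      using e2(1) by (metis inner_commute inner_scaleR_right mult_zero_right)
    then show False
      using e2(2) by simp
  qed
  ultimately show ?thesis
    using that[of D] D by (metis abs_ge_zero order_less_le)
qed

lemma sine_polar_linear_image:
  fixes f :: "'a::euclidean_space \<Rightarrow> 'a"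
  assumes f: "linear f" "inj f" and D: "0 < D" "\<And>x y. sine_bracket (f x) (f y) = D * sine_bracket x y"
  shows "sine_polar (f ` K) = (\<lambda>x. (1 / D) *\<^sub>R f x) ` sine_polar K"
proof (intro equalityI subsetI)
  fix x assume x: "x \<in> sine_polar (f ` K)"
  obtain z where z: "D *\<^sub>R x = f z"
    using linear_injective_imp_surjective[OF f] by (metis surj_def)
  have "sine_bracket z y \<le> 1" if "y \<in> K" for y
  proof -
    have "D * sine_bracket z y = D * sine_bracket x (f y)"
      using D z by (metis abs_of_pos sine_bracket_scaleR(2))
    then show ?thesis
      using x that D(1) by (auto simp: in_sine_polar_iff)
  qed
  then have "z \<in> sine_polar K"
    by (simp add: in_sine_polar_iff)
  moreover have "x = (1 / D) *\<^sub>R f z"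
    using D(1) by (simp flip: z)
  ultimately show "x \<in> (\<lambda>x. (1 / D) *\<^sub>R f x) ` sine_polar K"
    by blast
next
  fix x assume "x \<in> (\<lambda>x. (1 / D) *\<^sub>R f x) ` sine_polar K"
  then show "x \<in> sine_polar (f ` K)"
    using D by (auto simp: in_sine_polar_iff)
qed

text \<open>The unit disc is its own sine polar, so the polar of its image under \<open>f\<close> is
  the same ellipse scaled by \<open>1 / D\<close>, and area scales by the square.\<close>

lemma measure_product_ellipse:
  fixes f :: "'a::euclidean_space \<Rightarrow> 'a"
  assumes dim: "DIM('a) = 2" and f: "linear f" "inj f"
    and D: "0 < D" "\<And>x y. sine_bracket (f x) (f y) = D * sine_bracket x y"
  shows "measure lebesgue (f ` cball 0 1) * measure lebesgue (sine_polar (f ` cball 0 1))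
    = (volume_factor f / D)\<^sup>2 * (measure lebesgue (cball (0::'a) 1))\<^sup>2"
proof -
  have "sine_polar (cball (0::'a) 1) = cball 0 1"
    using sine_polar_cball[of 1, where 'a='a] dim by simp
  then have polar: "sine_polar (f ` cball 0 1) = (\<lambda>x. (1 / D) *\<^sub>R x) ` f ` cball 0 1"
    using sine_polar_linear_image[OF f D, of "cball 0 1"] by (simp add: image_image)
  have cpt: "compact (f ` cball 0 1)"
    using f(1) by (simp add: compact_linear_image)
  have scale: "linear (\<lambda>x::'a. (1 / D) *\<^sub>R x)" "inj (\<lambda>x::'a. (1 / D) *\<^sub>R x)"
    using D(1) by (auto intro: linear_scaleR injI)
  have "measure lebesgue (f ` cball 0 1) = volume_factor f * measure lebesgue (cball (0::'a) 1)"
    by (rule measure_linear_image_compact[OF f]) simp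
  moreover have "measure lebesgue (sine_polar (f ` cball 0 1)) = (1 / D)\<^sup>2 * measure lebesgue (f ` cball 0 1)"
    unfolding polar measure_linear_image_compact[OF scale cpt]
    using volume_factor_scaleR[of "1 / D", where 'a='a] D(1) dim by simp
  ultimately show ?thesis
    by (simp add: power2_eq_square)
qed

lemma linear_plane_diag:
  fixes e1 e2 e3 e4 :: "'a::euclidean_space"
  shows "linear (\<lambda>w. r *\<^sub>R ((a * (w \<bullet> e1)) *\<^sub>R e3 + (b * (w \<bullet> e2)) *\<^sub>R e4))"
  by (auto simp: linear_iff inner_add_left algebra_simps)

text \<open>Swapping the two axes conjugates the diagonal map \<open>f = r diag (1, s)\<close> to
  \<open>g = r diag (s, 1)\<close>, and \<open>f \<circ> g\<close> is a dilation.\<close>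
lemma volume_factor_diagonal:
  fixes e1 e2 :: "'a::euclidean_space"
  assumes dim: "DIM('a) = 2" and e: "norm e1 = 1" "norm e2 = 1" "e1 \<bullet> e2 = 0" and rs: "0 < r" "0 < s"
    and f_def: "f = (\<lambda>w. r *\<^sub>R ((w \<bullet> e1) *\<^sub>R e1 + (s * (w \<bullet> e2)) *\<^sub>R e2))"
  shows "linear f" "inj f" "volume_factor f = r\<^sup>2 * s" "sine_bracket (f e1) (f e2) = r\<^sup>2 * s"
proof -
  have ee: "e1 \<bullet> e1 = 1" "e2 \<bullet> e2 = 1" "e2 \<bullet> e1 = 0"
    using e by (simp_all add: power2_norm_eq_inner[symmetric] inner_commute)
  define g where "g = (\<lambda>w. r *\<^sub>R ((s * (w \<bullet> e1)) *\<^sub>R e1 + (w \<bullet> e2) *\<^sub>R e2))"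
  define J where "J = (\<lambda>w. (w \<bullet> e1) *\<^sub>R e2 + (w \<bullet> e2) *\<^sub>R e1)"
  note expand = orthonormal_plane_expansion[OF dim e]
  show lin_f: "linear f"
    using linear_plane_diag[of r 1 e1 e1 s e2 e2] by (simp add: f_def)
  have lin: "linear g" "linear J"
    using linear_plane_diag[of r s e1 e1 1 e2 e2] linear_plane_diag[of 1 1 e1 e2 1 e2 e1]
    by (simp_all add: g_def J_def)
  have fg: "f (g w) = (r\<^sup>2 * s) *\<^sub>R w" "g (f w) = (r\<^sup>2 * s) *\<^sub>R w" for w
  proof -
    have "f (g w) = (r\<^sup>2 * s) *\<^sub>R ((w \<bullet> e1) *\<^sub>R e1 + (w \<bullet> e2) *\<^sub>R e2)"
      "g (f w) = (r\<^sup>2 * s) *\<^sub>R ((w \<bullet> e1) *\<^sub>R e1 + (w \<bullet> e2) *\<^sub>R e2)"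
      by (simp_all add: f_def g_def inner_add_left ee e(3) power2_eq_square scaleR_add_right mult_ac)
    then show "f (g w) = (r\<^sup>2 * s) *\<^sub>R w" "g (f w) = (r\<^sup>2 * s) *\<^sub>R w"
      by (simp_all flip: expand)
  qed
  have "J (J w) = (w \<bullet> e1) *\<^sub>R e1 + (w \<bullet> e2) *\<^sub>R e2" for w
    by (simp add: J_def inner_add_left ee e(3))
  then have JJ: "J (J w) = w" for w
    using expand[of w] by metis
  have gJ: "g w = J (f (J w))" for w
    by (simp add: J_def f_def g_def inner_add_left ee e(3) algebra_simps)
  have rs2: "0 < r\<^sup>2 * s"
    using rs by simp
  show inj_f: "inj f"
  proof (rule injI)
    fix x y assume "f x = f y"
    then have "(r\<^sup>2 * s) *\<^sub>R x = (r\<^sup>2 * s) *\<^sub>R y"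
      by (metis fg(2))
    then show "x = y"
      using rs by simp
  qed
  have inj_J: "inj J"
    by (metis JJ injI)
  have inj_g: "inj g"
  proof (rule injI)
    fix x y assume "g x = g y"
    then have "J (f (J x)) = J (f (J y))"
      by (simp only: gJ)
    then show "x = y"
      using injD[OF inj_J] injD[OF inj_f] by blast
  qed
  \<comment> \<open>The involution \<open>J\<close> has a factor with square one, so conjugation by
    \<open>J\<close> gives \<open>f\<close> and \<open>g\<close> the same volume factor.\<close>
  have "volume_factor (\<lambda>x::'a. x) = 1"
    using volume_factor_scaleR[of 1, where 'a='a] by simp
  moreover have "volume_factor (\<lambda>x. J (J x)) = volume_factor J * volume_factor J"
    by (rule volume_factor_comp[OF lin(2) inj_J lin(2) inj_J])
  ultimately have JJ1: "volume_factor J * volume_factor J = 1"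
    by (simp add: JJ)
  have "linear (\<lambda>w. f (J w))" "inj (\<lambda>w. f (J w))"
    using linear_compose[OF lin(2) lin_f] inj_compose[OF inj_f inj_J] by (simp_all add: o_def)
  then have "volume_factor (\<lambda>w. J (f (J w))) = volume_factor J * (volume_factor f * volume_factor J)"
    using volume_factor_comp[OF lin(2) inj_J, of "\<lambda>w. f (J w)"]
      volume_factor_comp[OF lin_f inj_f lin(2) inj_J] by simp
  moreover have "g = (\<lambda>w. J (f (J w)))"
    by (rule ext) (rule gJ)
  ultimately have "volume_factor g = volume_factor J * (volume_factor f * volume_factor J)"
    by simp
  with JJ1 have "volume_factor g = volume_factor f"
    by (simp add: mult_ac)
  moreover have "volume_factor f * volume_factor g = volume_factor (\<lambda>x. f (g x))"
    by (rule volume_factor_comp[OF lin_f inj_f lin(1) inj_g, symmetric])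
  moreover have "volume_factor (\<lambda>x. f (g x)) = (r\<^sup>2 * s)\<^sup>2"
    unfolding fg using volume_factor_scaleR[OF rs2, where 'a='a] dim by simp
  ultimately have "(volume_factor f)\<^sup>2 = (r\<^sup>2 * s)\<^sup>2"
    by (simp add: power2_eq_square)
  then show "volume_factor f = r\<^sup>2 * s"
    using volume_factor_pos[OF lin_f inj_f] rs2 power2_eq_imp_eq less_imp_le by metis
  have fe: "f e1 = r *\<^sub>R e1 + 0 *\<^sub>R e2" "f e2 = 0 *\<^sub>R e1 + (r * s) *\<^sub>R e2"
    by (simp_all add: f_def ee e(3))
  show "sine_bracket (f e1) (f e2) = r\<^sup>2 * s"
    unfolding fe sine_bracket_plane[OF e] using rs by (simp add: power2_eq_square)
qed

section \<open>The sine Blaschke-Santalo inequality\<close>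

lemma omega_eq_measure_cball: "omega DIM('a::euclidean_space) = measure lebesgue (cball (0::'a) 1)"
  by (simp add: omega_def content_cball unit_ball_vol_def add.commute)

lemma measure_product_cball:
  assumes "0 < r"
  shows "measure lebesgue (cball (0::'a::euclidean_space) r) * measure lebesgue (cball (0::'a) (1 / r))
    = (omega DIM('a))\<^sup>2"
  using assms by (simp add: omega_eq_measure_cball content_cball power2_eq_square power_divide)

text \<open>In the plane the maximiser is a diagonal ellipse whose volume factor and bracket factor
  are both \<open>\<rho>\<^sup>2 * s\<close>; in higher dimensions it is a ball, with the ball of
  reciprocal radius as its polar.\<close>

lemma sine_maximal_measure_product:
  fixes K L :: "'a::euclidean_space set"
  assumes dim: "DIM('a) \<ge> 2" and R: "0 < R" and max: "sine_maximal R K L"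
  shows "measure lebesgue K * measure lebesgue L = (omega DIM('a))\<^sup>2"
proof (cases "DIM('a) = 2")
  case True
  obtain e1 e2 :: 'a and \<rho> s where e: "norm e1 = 1" "norm e2 = 1" "e1 \<bullet> e2 = 0" "0 < \<rho>" "0 < s"
    and K: "K = (\<lambda>w. \<rho> *\<^sub>R ((w \<bullet> e1) *\<^sub>R e1 + (s * (w \<bullet> e2)) *\<^sub>R e2)) ` cball 0 1"
    by (rule sine_maximal_plane_shape[OF True R max])
  define f where "f = (\<lambda>w. \<rho> *\<^sub>R ((w \<bullet> e1) *\<^sub>R e1 + (s * (w \<bullet> e2)) *\<^sub>R e2))"
  note diag = volume_factor_diagonal[OF True e f_def]
  obtain D where D: "0 < D" "\<And>x y. sine_bracket (f x) (f y) = D * sine_bracket x y"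
    using sine_bracket_linear_image_plane[OF True diag(1,2)] by metis
  have "sine_bracket e1 e2 = 1"
    using e by (simp add: sine_bracket_orthogonal)
  then have "D = \<rho>\<^sup>2 * s"
    using D(2)[of e1 e2] diag(4) by simp
  then have "volume_factor f / D = 1"
    using diag(3) e(4,5) by simp
  moreover have "L = sine_polar (f ` cball 0 1)"
    using sine_maximalD(3)[OF max] by (simp add: K f_def)
  ultimately show ?thesis
    using measure_product_ellipse[OF True diag(1,2) D] by (simp add: K f_def omega_eq_measure_cball)
next
  case False
  with dim have "DIM('a) \<ge> 3"
    by simp
  then obtain r where r: "0 < r" "K = cball 0 r"
    using sine_maximal_imp_cball[OF _ R max] by metis
  then have "L = cball 0 (1 / r)"
    using sine_maximalD(3)[OF max] sine_polar_cball[OF dim r(1)] by simp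
  then show ?thesis
    using measure_product_cball[OF r(1), where 'a='a] r(2) by simp
qed

lemma sine_class_measure_product_le:
  fixes K L :: "'a::euclidean_space set"
  assumes dim: "DIM('a) \<ge> 2" and R: "1 \<le> R" and KL: "(K, L) \<in> sine_class R"
  shows "measure lebesgue K * measure lebesgue L \<le> (omega DIM('a))\<^sup>2"
proof -
  obtain K' L' :: "'a set" where max: "sine_maximal R K' L'"
    using exists_sine_maximal[OF dim R] by metis
  then show ?thesis
    using sine_maximalD(4)[OF max KL] sine_maximal_measure_product[OF dim _ max] R by simp
qed

section \<open>The inequality for bounded measurable sets\<close>

lemma bounded_sine_polar:
  fixes K :: "'a::euclidean_space set"
  assumes "\<not> (\<exists>L. subspace L \<and> dim L = 1 \<and> K \<subseteq> L)"
  shows "bounded (sine_polar K)"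
proof -
  have dim1: "dim (span {y}) = 1" if "y \<noteq> 0" for y :: 'a
    using that by (simp add: dim_span dim_singleton)
  obtain b :: 'a where "b \<in> Basis"
    using nonempty_Basis by blast
  \<comment> \<open>Some line through \<open>0\<close> exists, which gives a nonzero point of
    \<open>K\<close>; the line through that point then gives a second, independent one.\<close>
  then have "\<not> K \<subseteq> span {b}"
    using assms dim1[of b] subspace_span nonzero_Basis by blast
  then obtain y1 where y1: "y1 \<in> K" "y1 \<noteq> 0"
    using span_zero by blast
  then have "\<not> K \<subseteq> span {y1}"
    using assms dim1 subspace_span by blast
  then obtain y2 where y2: "y2 \<in> K" "y2 \<notin> span {y1}"
    by blast
  \<comment> \<open>The two seminorms vanish only on the lines of \<open>y1\<close> and
    \<open>y2\<close> respectively, so their sum is a norm. It is at most two on the polar, and its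
    minimum on the unit sphere bounds the polar.\<close>
  let ?N = "\<lambda>x. sine_bracket x y1 + sine_bracket x y2"
  have pos: "0 < ?N x" if "norm x = 1" for x
  proof (rule ccontr)
    assume "\<not> 0 < ?N x"
    then have "sine_bracket x y1 = 0" "sine_bracket x y2 = 0"
      using sine_bracket_nonneg[of x y1] sine_bracket_nonneg[of x y2] by linarith+
    moreover have "x \<noteq> 0"
      using that by auto
    ultimately obtain a b where ab: "y1 = a *\<^sub>R x" "y2 = b *\<^sub>R x"
      using sine_bracket_eq_0D by metis
    then have "a \<noteq> 0"
      using y1 by auto
    then have "y2 = (b / a) *\<^sub>R y1"
      by (simp add: ab)
    then show False
      using y2(2) by (metis insertI1 span_base span_mul)
  qed
  obtain v :: 'a where "norm v = 1"
    using vector_choose_size[of 1] by auto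
  then have "v \<in> sphere 0 1"
    by simp
  then have "sphere (0::'a) 1 \<noteq> {}"
    by blast
  moreover have "continuous_on (sphere 0 1) ?N"
    by (intro continuous_intros)
  ultimately have "\<exists>x0\<in>sphere 0 1. \<forall>x\<in>sphere 0 1. ?N x0 \<le> ?N x"
    by (intro continuous_attains_inf) simp_all
  then obtain x0 where x0: "x0 \<in> sphere 0 1" "\<And>x. x \<in> sphere 0 1 \<Longrightarrow> ?N x0 \<le> ?N x"
    by blast
  define m where "m = ?N x0"
  have m: "0 < m"
    using pos[of x0] x0(1) by (simp add: m_def)
  have "norm x \<le> 2 / m" if "x \<in> sine_polar K" for x
  proof (cases "x = 0")
    case False
    have "m \<le> ?N ((1 / norm x) *\<^sub>R x)"
      unfolding m_def using False by (intro x0(2)) simp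
    also have "\<dots> = ?N x / norm x"
      by (simp add: add_divide_distrib)
    also have "?N x \<le> 2"
    proof -
      have "sine_bracket x y1 \<le> 1" "sine_bracket x y2 \<le> 1"
        using that y1(1) y2(1) in_sine_polar_iff by blast+
      then show ?thesis by simp
    qed
    finally show ?thesis
      using m False by (simp add: field_simps divide_right_mono)
  qed (use m in simp)
  then show ?thesis
    unfolding bounded_iff by blast
qed

lemma sine_polar_pair_in_class:
  fixes K :: "'a::euclidean_space set"
  assumes dim: "DIM('a) \<ge> 2" and "bounded K" "bounded (sine_polar K)"
  obtains R where "1 \<le> R" "(sine_polar (sine_polar K), sine_polar K) \<in> sine_class R"
proof -
  obtain R1 R2 where "\<And>x. x \<in> K \<Longrightarrow> norm x \<le> R1" "\<And>x. x \<in> sine_polar K \<Longrightarrow> norm x \<le> R2"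
    using assms(2,3) unfolding bounded_iff by blast
  then have R: "K \<subseteq> cball 0 (max 1 (max R1 R2))" "sine_polar K \<subseteq> cball 0 (max 1 (max R1 R2))"
    by (force simp: le_max_iff_disj)+
  have "compact (sine_polar K)"
    using assms(3) closed_sine_polar by (simp add: compact_eq_bounded_closed)
  then have "(sine_polar (sine_polar K), sine_polar K) \<in> sine_class (max 1 (max R1 R2))"
    using R dim by (intro sine_polar_mem_sine_class cball_subset_sine_polar) auto
  then show ?thesis
    by (intro that) auto
qed

text \<open>The bipolar contains \<open>K\<close> and has the same polar; together with that polar
  it lies in \<open>sine_class R\<close> for some \<open>R\<close>.\<close>

lemma measure_sine_polar_product_le:
  fixes K :: "'a::euclidean_space set"
  assumes dim: "DIM('a) \<ge> 2" and K: "bounded K" "K \<in> sets lebesgue" and L: "bounded (sine_polar K)"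
  shows "measure lebesgue K \<le> measure lebesgue (sine_polar (sine_polar K))"
    and "measure lebesgue K * measure lebesgue (sine_polar K) \<le> (omega DIM('a))\<^sup>2"
proof -
  obtain R where R: "1 \<le> R" "(sine_polar (sine_polar K), sine_polar K) \<in> sine_class R"
    using sine_polar_pair_in_class[OF dim K(1) L] by metis
  then have "compact (sine_polar (sine_polar K))"
    by (simp add: sine_class_def)
  then show le: "measure lebesgue K \<le> measure lebesgue (sine_polar (sine_polar K))"
    using K(2) subset_sine_polar_sine_polar by (intro measure_mono_fmeasurable) (auto simp: lmeasurable_compact)
  have "measure lebesgue K * measure lebesgue (sine_polar K)
      \<le> measure lebesgue (sine_polar (sine_polar K)) * measure lebesgue (sine_polar K)"
    using le by (intro mult_right_mono) auto
  then show "measure lebesgue K * measure lebesgue (sine_polar K) \<le> (omega DIM('a))\<^sup>2"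
    using sine_class_measure_product_le[OF dim R] by linarith
qed

text \<open>The volume product of the ellipse is \<open>(volume_factor f / D)\<^sup>2\<close> times
  that of the unit disc, which attains the bound in the inequality.\<close>

lemma volume_factor_le_plane:
  fixes f :: "'a::euclidean_space \<Rightarrow> 'a"
  assumes dim: "DIM('a) = 2" and f: "linear f" "inj f"
    and D: "0 < D" "\<And>x y. sine_bracket (f x) (f y) = D * sine_bracket x y"
  shows "volume_factor f \<le> D"
proof -
  let ?E = "f ` cball 0 1" and ?w = "measure lebesgue (cball (0::'a) 1)"
  have "sine_polar ?E = (\<lambda>x. (1 / D) *\<^sub>R f x) ` sine_polar (cball 0 1)"
    by (rule sine_polar_linear_image[OF f D])
  also have "sine_polar (cball (0::'a) 1) = cball 0 1"
    using sine_polar_cball[of 1, where 'a='a] dim by simp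
  finally have "compact (sine_polar ?E)"
    using compact_linear_image[of "\<lambda>x. (1 / D) *\<^sub>R f x"] linear_compose_scale_right[OF f(1)] by simp
  moreover have "compact ?E"
    using f(1) by (simp add: compact_linear_image)
  ultimately have "measure lebesgue ?E * measure lebesgue (sine_polar ?E) \<le> (omega DIM('a))\<^sup>2"
    using dim by (intro measure_sine_polar_product_le)
      (auto simp: compact_imp_bounded fmeasurableD lmeasurable_compact)
  then have "(volume_factor f / D)\<^sup>2 * ?w\<^sup>2 \<le> 1 * ?w\<^sup>2"
    unfolding measure_product_ellipse[OF dim f D] omega_eq_measure_cball by simp
  moreover have "0 < ?w\<^sup>2"
    using content_cball_pos[of 1 "0::'a"] by simp
  ultimately have "(volume_factor f / D)\<^sup>2 \<le> 1"
    by (metis mult_le_cancel_right_pos)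
  then show ?thesis
    using D(1) by (simp add: abs_square_le_1)
qed

text \<open>Applying the inequality to both \<open>f\<close> and its inverse identifies the volume factor of \<open>f\<close>
  with the factor by which \<open>f\<close> scales the bracket.\<close>
lemma measure_product_ellipse_eq:
  fixes f :: "'a::euclidean_space \<Rightarrow> 'a"
  assumes dim: "DIM('a) = 2" and f: "linear f" "inj f"
  shows "measure lebesgue (f ` cball 0 1) * measure lebesgue (sine_polar (f ` cball 0 1))
    = (omega DIM('a))\<^sup>2"
proof -
  obtain D where D: "0 < D" "\<And>x y. sine_bracket (f x) (f y) = D * sine_bracket x y"
    using sine_bracket_linear_image_plane[OF dim f] by metis
  obtain g where g: "linear g" "\<And>x. f (g x) = x"
    using linear_injective_isomorphism[OF f] by metis
  have "inj g"
    by (metis g(2) injI)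
  have D': "sine_bracket (g x) (g y) = 1 / D * sine_bracket x y" for x y
    using D(1) D(2)[of "g x" "g y"] by (simp add: g(2))
  have "volume_factor f * volume_factor g = volume_factor (\<lambda>x. f (g x))"
    by (rule volume_factor_comp[OF f g(1) \<open>inj g\<close>, symmetric])
  also have "\<dots> = 1"
    using volume_factor_scaleR[of 1, where 'a='a] by (simp add: g(2))
  finally have "1 = volume_factor f * volume_factor g" ..
  also have "\<dots> \<le> volume_factor f * (1 / D)"
    using volume_factor_le_plane[OF dim g(1) \<open>inj g\<close> _ D'] D(1) volume_factor_pos[OF f]
    by (intro mult_left_mono) auto
  finally have "D \<le> volume_factor f"
    using D(1) by (simp add: field_simps)
  then have "volume_factor f / D = 1"
    using volume_factor_le_plane[OF dim f D] D(1) by simp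
  then show ?thesis
    unfolding measure_product_ellipse[OF dim f D] omega_eq_measure_cball by simp
qed

section \<open>The equality case\<close>

lemma compact_star_body:
  assumes "star_body K"
  shows "compact K"
proof -
  obtain \<rho> :: "'a \<Rightarrow> real" where \<rho>: "continuous_on (sphere 0 1) \<rho>" "\<And>u. u \<in> sphere 0 1 \<Longrightarrow> 0 < \<rho> u"
    and K: "K = {r *\<^sub>R u | r u. u \<in> sphere 0 1 \<and> 0 \<le> r \<and> r \<le> \<rho> u}"
    using assms by (auto simp: star_body_def)
  \<comment> \<open>These are polar coordinates with the radius rescaled to the unit interval, which
    exhibit \<open>K\<close> as a continuous image of a compact product.\<close>
  let ?h = "\<lambda>z. (snd z * \<rho> (fst z)) *\<^sub>R fst z"
  have "continuous_on (sphere 0 1 \<times> {0..1}) ?h"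
    by (intro continuous_intros continuous_on_compose2[OF \<rho>(1)]) auto
  then have "compact (?h ` (sphere 0 1 \<times> {0..1}))"
    by (intro compact_continuous_image compact_Times) auto
  moreover have "?h ` (sphere 0 1 \<times> {0..1}) = K"
  proof (intro equalityI subsetI)
    fix x assume "x \<in> ?h ` (sphere 0 1 \<times> {0..1})"
    then obtain u t where "u \<in> sphere 0 1" "0 \<le> t" "t \<le> 1" "x = (t * \<rho> u) *\<^sub>R u"
      by auto
    then show "x \<in> K"
      unfolding K using \<rho>(2)[of u] by (auto intro!: exI[of _ "t * \<rho> u"] exI[of _ u] simp: mult_left_le_one_le)
  next
    fix x assume "x \<in> K"
    then obtain r u where u: "u \<in> sphere 0 1" "0 \<le> r" "r \<le> \<rho> u" "x = r *\<^sub>R u"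
      unfolding K by blast
    then show "x \<in> ?h ` (sphere 0 1 \<times> {0..1})"
      using \<rho>(2)[of u] by (intro image_eqI[of _ _ "(u, r / \<rho> u)"]) auto
  qed
  ultimately show ?thesis
    by simp
qed

text \<open>Equality bounds the volume of the bipolar by that of \<open>K\<close>, so the compact
  set \<open>K\<close> equals its bipolar. The value of the product is then the upper bound for the
  whole class.\<close>

lemma sine_maximal_of_equality:
  fixes K :: "'a::euclidean_space set"
  assumes dim: "DIM('a) \<ge> 2" and K: "compact K" and L: "bounded (sine_polar K)"
    and eq: "measure lebesgue K * measure lebesgue (sine_polar K) = (omega DIM('a))\<^sup>2"
  obtains R where "0 < R" "sine_maximal R K (sine_polar K)"
proof -
  let ?L = "sine_polar K" and ?K = "sine_polar (sine_polar K)"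
  obtain R where R: "1 \<le> R" "(?K, ?L) \<in> sine_class R"
    using sine_polar_pair_in_class[OF dim compact_imp_bounded[OF K] L] by metis
  have "0 < measure lebesgue ?L"
    using sine_class_measure_pos[OF R(2)] R(1) by simp
  moreover have "measure lebesgue ?K * measure lebesgue ?L \<le> measure lebesgue K * measure lebesgue ?L"
    unfolding eq by (rule sine_class_measure_product_le[OF dim R])
  ultimately have le: "measure lebesgue ?K \<le> measure lebesgue K"
    by simp
  have "ball 0 (1 / R) \<subseteq> ?K"
    using R(2) ball_subset_cball by (fastforce simp: sine_class_def)
  then have "ball 0 (1 / R) \<subseteq> interior ?K"
    by (simp add: interior_maximal)
  then have "interior ?K \<noteq> {}"
    using R(1) by auto
  moreover have "compact ?K"
    using R(2) by (simp add: sine_class_def)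
  ultimately have "K = ?K"
    using K le by (intro compact_eq_convex_of_measure_le convex_sine_polar subset_sine_polar_sine_polar)
  moreover from this have "(K, ?L) \<in> sine_class R"
    using R(2) by simp
  moreover have "measure lebesgue K' * measure lebesgue L' \<le> measure lebesgue K * measure lebesgue ?L"
    if "(K', L') \<in> sine_class R" for K' L' :: "'a set"
    unfolding eq by (rule sine_class_measure_product_le[OF dim R(1) that])
  ultimately have "sine_maximal R K ?L"
    unfolding sine_maximal_def by blast
  then show ?thesis
    using R(1) by (intro that[of R]) auto
qed

theorem theorem5p2:
  fixes K :: "'a::euclidean_space set"
  assumes "DIM('a) \<ge> 2"
    and "bounded K" and "K \<in> sets lebesgue"
    and "\<not> (\<exists>L. subspace L \<and> dim L = 1 \<and> K \<subseteq> L)"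
  shows "measure lebesgue K * measure lebesgue (sine_polar K) \<le> (omega DIM('a))\<^sup>2 \<and>
         (star_body K \<longrightarrow>
           (measure lebesgue K * measure lebesgue (sine_polar K) = (omega DIM('a))\<^sup>2 \<longleftrightarrow>
            (if DIM('a) = 2 then origin_ellipsoid K else origin_ball K)))"
proof (intro conjI impI iffI)
  note L = bounded_sine_polar[OF assms(4)]
  show "measure lebesgue K * measure lebesgue (sine_polar K) \<le> (omega DIM('a))\<^sup>2"
    by (rule measure_sine_polar_product_le[OF assms(1-3) L])
next
  assume star: "star_body K"
    and eq: "measure lebesgue K * measure lebesgue (sine_polar K) = (omega DIM('a))\<^sup>2"
  obtain R where R: "0 < R" "sine_maximal R K (sine_polar K)"
    using sine_maximal_of_equality[OF assms(1) compact_star_body[OF star] bounded_sine_polar[OF assms(4)] eq]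
    by metis
  show "if DIM('a) = 2 then origin_ellipsoid K else origin_ball K"
  proof (cases "DIM('a) = 2")
    case True
    obtain e1 e2 :: 'a and \<rho> s where e: "norm e1 = 1" "norm e2 = 1" "e1 \<bullet> e2 = 0" "0 < \<rho>" "0 < s"
      and K: "K = (\<lambda>w. \<rho> *\<^sub>R ((w \<bullet> e1) *\<^sub>R e1 + (s * (w \<bullet> e2)) *\<^sub>R e2)) ` cball 0 1"
      by (rule sine_maximal_plane_shape[OF True R])
    have "origin_ellipsoid K"
      unfolding origin_ellipsoid_def using volume_factor_diagonal(1,2)[OF True e refl] K by blast
    with True show ?thesis by simp
  next
    case False
    with assms(1) have "DIM('a) \<ge> 3" by simp
    then have "origin_ball K"
      using sine_maximal_imp_cball[OF _ R] by (metis origin_ball_def)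
    with False show ?thesis by simp
  qed
next
  assume shape: "if DIM('a) = 2 then origin_ellipsoid K else origin_ball K"
  show "measure lebesgue K * measure lebesgue (sine_polar K) = (omega DIM('a))\<^sup>2"
  proof (cases "DIM('a) = 2")
    case True
    then have "origin_ellipsoid K"
      using shape by simp
    then show ?thesis
      unfolding origin_ellipsoid_def using measure_product_ellipse_eq[OF True] by blast
  next
    case False
    then have "origin_ball K"
      using shape by simp
    then obtain r where "0 < r" "K = cball 0 r"
      unfolding origin_ball_def by blast
    then show ?thesis
      using measure_product_cball[of r, where 'a='a] sine_polar_cball[OF assms(1)] by simp
  qed
qed

end
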